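(* Let $0<\alpha<1$, $\gamma\ge0$ with $0<\alpha+\gamma\le1$. Let $(X_t,\ t\ge0)$ be the Ornstein-Uhlenbeck process, i.e. the diffusion on $\mathbb{R}$ with infinitesimal mean and variance $$\mu(x)=-\theta(x-\mu),\qquad\sigma^2(x)=2\theta\sigma^2,$$ where $\theta>0$, $\mu\in\mathbb{R}$, $\sigma^2>0$. Let $\boldsymbol{m}(x)=\frac{1}{\sqrt{2\pi\sigma^2}}\exp\left(-\frac{(x-\mu)^2}{2\sigma^2}\right)$ and let $(Q_n)_{n\ge0}$ be the orthonormal (Hermite) polynomials with respect to $\boldsymbol{m}$. Let $(X^{(\alpha,\gamma)}_t,\ t\ge0)$ be the stretched non-local Ornstein-Uhlenbeck process with initial density $f$ (the density of $X^{(\alpha,\gamma)}_0$) such that $f/\boldsymbol{m}\in L_2(\boldsymbol{m}(x)dx)$ and $\sum_na_nQ_n$, with $a_n=\int_{\mathbb{R}}f(y)Q_n(y)\,dy$, converges to $f/\boldsymbol{m}$ uniformly on finite intervals. Then the density $p_{\alpha,\gamma}(t,x)$ of $X^{(\alpha,\gamma)}_t$ satisfies $$p_{\alpha,\gamma}(t,x)\to\frac{1}{\sqrt{2\pi\sigma^2}}\exp\left(-\frac{(x-\mu)^2}{2\sigma^2}\right),\qquad\text{as }t\to\infty .$$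
   Context: The convergence is pointwise in $x\in\mathbb{R}$. The stretched non-local process is $X^{(\alpha,\gamma)}_t:=X_{t^{\alpha+\gamma}Z}$, where $Z=\int_0^\infty(1-\sigma^\alpha_s)_+^\gamma\,ds$ is independent of $(X_t)$ and $(\sigma^\alpha_s,s\ge0)$ is the $\alpha$-stable subordinator with $\mathbb{E}e^{-\lambda\sigma^\alpha_s}=e^{-s\lambda^\alpha}$ (with $(u)_+^\gamma=u^\gamma$ for $u>0$, $0$ for $u\le 0$). The density of $X^{(\alpha,\gamma)}_t$, $t>0$, is taken to be $p_{\alpha,\gamma}(t,x)=\int\boldsymbol{p}_{\alpha,\gamma}(x,t;y)f(y)\,dy$, where $$\boldsymbol{p}_{\alpha,\gamma}(x,t;y)=\boldsymbol{m}(x)\sum_{n=0}^\infty\operatorname{E}_{\alpha,1+\gamma/\alpha,\gamma/\alpha}(-\lambda_nt^{\alpha+\gamma})Q_n(x)Q_n(y),\qquad\lambda_n=\theta n,$$ is the transition density of $X^{(\alpha,\gamma)}$; here the Kilbas-Saigo function is $\operatorname{E}_{a,m,l}(z)=\sum_{n\ge0}c_nz^n$, $c_0=1$, $c_n=\prod_{k=0}^{n-1}\frac{\Gamma[1+a(km+l)]}{\Gamma[1+a(km+l+1)]}$. The generator of $X$ is $\mu(x)\frac{d}{dx}+\frac{\sigma^2(x)}{2}\frac{d^2}{dx^2}$, and $Q_n$ has degree $n$ and is its eigenfunction with eigenvalue $-\lambda_n$. *)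

theory Defs
  imports "HOL-Probability.Probability" "HOL-Computational_Algebra.Polynomial"
begin

definition natural_filtration :: "'a measure \<Rightarrow> (real \<Rightarrow> 'a \<Rightarrow> real) \<Rightarrow> real \<Rightarrow> 'a measure" where
  "natural_filtration M X s =
     sigma (space M) {X u -` A \<inter> space M | u A. 0 \<le> u \<and> u \<le> s \<and> A \<in> sets borel}"

(* K h x is the law of the state at time h of the process started at x. *)
definition markov_semigroup :: "(real \<Rightarrow> real \<Rightarrow> real measure) \<Rightarrow> bool" where
  "markov_semigroup K \<longleftrightarrow>
     (\<forall>h\<ge>0. K h \<in> borel \<rightarrow>\<^sub>M prob_algebra borel) \<and>
     (\<forall>x. K 0 x = return borel x) \<and>
     (\<forall>s\<ge>0. \<forall>h\<ge>0. \<forall>x. K (s + h) x = K s x \<bind> K h)"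

(* b x = lim E[X_h - x | X_0 = x] / h  and  a x = lim E[(X_h - x)^2 | X_0 = x] / h  as h -> 0+,
   together with P(|X_h - x| > e | X_0 = x) = o(h) for every e > 0; the integrability clause
   excludes the value 0 that the library gives to the integral of a non-integrable function. *)
definition infinitesimal_mean_variance ::
    "(real \<Rightarrow> real \<Rightarrow> real measure) \<Rightarrow> (real \<Rightarrow> real) \<Rightarrow> (real \<Rightarrow> real) \<Rightarrow> bool" where
  "infinitesimal_mean_variance K b a \<longleftrightarrow>
     (\<forall>x. (\<forall>\<^sub>F h in at_right 0. integrable (K h x) (\<lambda>y. (y - x)\<^sup>2)) \<and>
          ((\<lambda>h. (\<integral>y. (y - x) \<partial>K h x) / h) \<longlongrightarrow> b x) (at_right 0) \<and>
          ((\<lambda>h. (\<integral>y. (y - x)\<^sup>2 \<partial>K h x) / h) \<longlongrightarrow> a x) (at_right 0) \<and>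
          (\<forall>e>0. ((\<lambda>h. measure (K h x) {y. \<bar>y - x\<bar> > e} / h) \<longlongrightarrow> 0) (at_right 0)))"

(* Time-homogeneous Markov process on the real line with continuous paths and with infinitesimal
   mean b and infinitesimal variance a, i.e. with generator b d/dx + (a/2) d^2/dx^2.
   The initial law is arbitrary; times are restricted to t >= 0. *)
definition diffusion ::
    "'a measure \<Rightarrow> (real \<Rightarrow> real) \<Rightarrow> (real \<Rightarrow> real) \<Rightarrow> (real \<Rightarrow> 'a \<Rightarrow> real) \<Rightarrow> bool" where
  "diffusion M b a X \<longleftrightarrow>
     (\<forall>t\<ge>0. X t \<in> borel_measurable M) \<and>
     (\<forall>\<omega>\<in>space M. continuous_on {0..} (\<lambda>t. X t \<omega>)) \<and>
     (\<exists>K. markov_semigroup K \<and> infinitesimal_mean_variance K b a \<and>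
        (\<forall>s\<ge>0. \<forall>h\<ge>0. \<forall>B\<in>sets borel.
           AE \<omega> in M. real_cond_exp M (natural_filtration M X s)
                         (indicator {\<omega>'\<in>space M. X (s + h) \<omega>' \<in> B}) \<omega>
                       = measure (K h (X s \<omega>)) B))"

definition ou_process ::
    "'a measure \<Rightarrow> real \<Rightarrow> real \<Rightarrow> real \<Rightarrow> (real \<Rightarrow> 'a \<Rightarrow> real) \<Rightarrow> bool" where
  "ou_process M \<theta> \<mu> \<sigma> X \<longleftrightarrow>
     diffusion M (\<lambda>x. - \<theta> * (x - \<mu>)) (\<lambda>x. 2 * \<theta> * \<sigma>\<^sup>2) X"

definition stable_subordinator :: "'a measure \<Rightarrow> real \<Rightarrow> (real \<Rightarrow> 'a \<Rightarrow> real) \<Rightarrow> bool" where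
  "stable_subordinator M \<alpha> S \<longleftrightarrow>
     (\<forall>s\<ge>0. S s \<in> borel_measurable M) \<and>
     (\<forall>\<omega>\<in>space M. S 0 \<omega> = 0 \<and> mono_on {0..} (\<lambda>s. S s \<omega>) \<and>
        (\<forall>s\<ge>0. continuous (at_right s) (\<lambda>s. S s \<omega>))) \<and>
     (\<forall>(u :: nat \<Rightarrow> real) n. 0 \<le> u 0 \<and> mono u \<longrightarrow>
        prob_space.indep_vars M (\<lambda>_. borel) (\<lambda>i \<omega>. S (u (Suc i)) \<omega> - S (u i) \<omega>) {..<n}) \<and>
     (\<forall>s\<ge>0. \<forall>h\<ge>0. distr M borel (\<lambda>\<omega>. S (s + h) \<omega> - S s \<omega>) = distr M borel (S h)) \<and>
     (\<forall>s\<ge>0. \<forall>r\<ge>0. (\<integral>\<omega>. exp (- r * S s \<omega>) \<partial>M) = exp (- s * r powr \<alpha>))"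

(* Since 0 powr g = 0 for every g, max 0 u powr g is u^g for u > 0 and 0 for u <= 0,
   also when g = 0. *)
definition stretch_variable :: "real \<Rightarrow> (real \<Rightarrow> 'a \<Rightarrow> real) \<Rightarrow> 'a \<Rightarrow> real" where
  "stretch_variable \<gamma> S \<omega> = (LINT s:{0..}|lborel. max 0 (1 - S s \<omega>) powr \<gamma>)"

definition stretched_process ::
    "real \<Rightarrow> real \<Rightarrow> (real \<Rightarrow> 'a \<Rightarrow> real) \<Rightarrow> ('a \<Rightarrow> real) \<Rightarrow> real \<Rightarrow> 'a \<Rightarrow> real" where
  "stretched_process \<alpha> \<gamma> X Z t \<omega> = X (t powr (\<alpha> + \<gamma>) * Z \<omega>) \<omega>"

definition independent_of_process ::
    "'a measure \<Rightarrow> ('a \<Rightarrow> real) \<Rightarrow> (real \<Rightarrow> 'a \<Rightarrow> real) \<Rightarrow> bool" where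
  "independent_of_process M Z X \<longleftrightarrow>
     prob_space.indep_set M
       {Z -` A \<inter> space M | A. A \<in> sets borel}
       {(\<lambda>\<omega>. \<lambda>t\<in>{0..}. X t \<omega>) -` A \<inter> space M | A. A \<in> sets (\<Pi>\<^sub>M t\<in>{0..}. borel)}"

definition orthonormal_polynomials :: "(real \<Rightarrow> real) \<Rightarrow> (nat \<Rightarrow> real poly) \<Rightarrow> bool" where
  "orthonormal_polynomials w Q \<longleftrightarrow>
     (\<forall>n. degree (Q n) = n) \<and>
     (\<forall>i j. has_bochner_integral lborel (\<lambda>x. poly (Q i) x * poly (Q j) x * w x)
              (if i = j then 1 else 0))"

definition kilbas_saigo_coeff :: "real \<Rightarrow> real \<Rightarrow> real \<Rightarrow> nat \<Rightarrow> real" where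
  "kilbas_saigo_coeff a m l n =
     (\<Prod>k<n. Gamma (1 + a * (real k * m + l)) / Gamma (1 + a * (real k * m + l + 1)))"

definition kilbas_saigo :: "real \<Rightarrow> real \<Rightarrow> real \<Rightarrow> real \<Rightarrow> real" where
  "kilbas_saigo a m l z = (\<Sum>n. kilbas_saigo_coeff a m l n * z ^ n)"

definition stretched_ou_transition_density ::
    "real \<Rightarrow> real \<Rightarrow> real \<Rightarrow> real \<Rightarrow> real \<Rightarrow> (nat \<Rightarrow> real poly) \<Rightarrow> real \<Rightarrow> real \<Rightarrow> real \<Rightarrow> real" where
  "stretched_ou_transition_density \<alpha> \<gamma> \<theta> \<mu> \<sigma> Q x t y =
     normal_density \<mu> \<sigma> x *
     (\<Sum>n. kilbas_saigo \<alpha> (1 + \<gamma> / \<alpha>) (\<gamma> / \<alpha>) (- (\<theta> * real n) * t powr (\<alpha> + \<gamma>))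
            * poly (Q n) x * poly (Q n) y)"

(* The version of the density at time t > 0 of the stretched process with initial density f that
   is given by the spectral expansion; being defined for every x, it admits pointwise limits. *)
definition stretched_ou_density ::
    "real \<Rightarrow> real \<Rightarrow> real \<Rightarrow> real \<Rightarrow> real \<Rightarrow> (nat \<Rightarrow> real poly) \<Rightarrow> (real \<Rightarrow> real) \<Rightarrow> real \<Rightarrow> real \<Rightarrow> real"
  where
  "stretched_ou_density \<alpha> \<gamma> \<theta> \<mu> \<sigma> Q f t x =
     (\<integral>y. stretched_ou_transition_density \<alpha> \<gamma> \<theta> \<mu> \<sigma> Q x t y * f y \<partial>lborel)"

end

theory Submission
  imports Defs "HOL-Real_Asymp.Real_Asymp"
begin

text \<open>
  Write $F$ for the function $z \mapsto E(-z)$, where $E$ is the Kilbas-Saigo function. Its Taylor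
  coefficients are limits of coefficients of finitely many Beta mixtures of exponentials, so that $F$ is nonnegative and
  decreasing for $z \ge 0$, and the integral equation that $F$ satisfies then gives $F(z) \le C / z$.
  The orthonormal polynomials are, up to sign, normalized Hermite polynomials, and a discrete energy
  argument gives $Q_n(x) = O(n^{-1/4})$ for fixed $x$. Hence the spectral expansion converges absolutely,
  may be integrated against $f$ term by term, and all its terms with $n \ge 1$ together are
  $O(t^{-(\alpha+\gamma)})$, while the term $n = 0$ is the stationary density.
\<close>

section \<open>Alternating series with nonnegative decreasing sums\<close>

text \<open>The obstacle is that F decays only like 1/z while the eigenvalues grow only linearly in
  n: the n-th term of the expansion is then controlled by |Q_n(x)| / n, and mere boundedness of
  Q_n(x) would leave a harmonic series. Any power saving would do; n^(-1/4) produces the summable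
  n^(-5/4). On the side of f it is enough that f Q_n is bounded in L1 uniformly in n. Since C / z
  with z = \<theta> n t^(\<alpha>+\<gamma>) splits into a factor in t and a factor in n, one
  convergent series serves all t at once. The sign and the monotonicity of an alternating series
  cannot be read off its coefficients. They are therefore carried by a class of series that contains
  the exponentials and is closed under multiplying the coefficients by the moments of a positive
  weight on [0,1] and under coefficientwise limits with a common entire majorant.\<close>

definition alt_series :: "(nat \<Rightarrow> real) \<Rightarrow> real \<Rightarrow> real" where
  "alt_series c z = (\<Sum>n. c n * (- z) ^ n)"

text \<open>A weak substitute for complete monotonicity on the half-line: just enough to survive
  mixtures and limits, and just what the 1/z estimate uses. Nonnegative coefficients make every
  series absolutely convergent.\<close>

definition decreasing_alt_series :: "(nat \<Rightarrow> real) \<Rightarrow> bool" where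
  "decreasing_alt_series c \<longleftrightarrow>
     (\<forall>n. 0 \<le> c n) \<and> (\<forall>z. summable (\<lambda>n. c n * z ^ n)) \<and>
     (\<forall>x y. 0 \<le> x \<longrightarrow> x \<le> y \<longrightarrow> 0 \<le> alt_series c y \<and> alt_series c y \<le> alt_series c x)"

text \<open>Fubini for power series: averaging the rescaled series over g multiplies the n-th
  coefficient by the n-th moment of g. The range of g is restricted only where w is nonzero, so that
  weights supported in [0,1] can be used on the whole line; there |g^n w| \<le> |w| gives the
  domination.\<close>

lemma alt_series_power_mixture:
  fixes c :: "nat \<Rightarrow> real" and w g :: "'a \<Rightarrow> real"
  assumes c: "\<And>n. 0 \<le> c n" "\<And>z. summable (\<lambda>n. c n * z ^ n)"
    and w: "integrable M w" and g: "g \<in> borel_measurable M"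
    and g01: "\<And>x. w x \<noteq> 0 \<Longrightarrow> 0 \<le> g x \<and> g x \<le> 1"
  shows "(\<lambda>n. c n * (\<integral>x. g x ^ n * w x \<partial>M) * (- z) ^ n) sums (\<integral>x. alt_series c (z * g x) * w x \<partial>M)"
    and "integrable M (\<lambda>x. alt_series c (z * g x) * w x)"
    and "summable (\<lambda>n. c n * (\<integral>x. g x ^ n * w x \<partial>M) * z ^ n)"
proof -
  have [measurable]: "g \<in> borel_measurable M" "w \<in> borel_measurable M"
    using g w by auto
  have le: "norm (g x ^ n * w x) \<le> norm (w x)" for x n
  proof (cases "w x = 0")
    case False
    with g01 have "0 \<le> g x" "g x \<le> 1" by auto
    hence "\<bar>g x ^ n\<bar> \<le> 1" by (simp add: power_le_one)
    thus ?thesis by (simp add: abs_mult mult_left_le_one_le)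
  qed auto
  have int0: "integrable M (\<lambda>x. g x ^ n * w x)" for n
    by (rule Bochner_Integration.integrable_bound[OF w _ AE_I2]) (use le in auto)
  have absz: "summable (\<lambda>n. \<bar>c n * z ^ n\<bar>)" for z
  proof -
    have "\<bar>c n * z ^ n\<bar> = c n * \<bar>z\<bar> ^ n" for n
      using c(1)[of n] by (simp add: abs_mult power_abs)
    thus ?thesis using c(2)[of "\<bar>z\<bar>"] by simp
  qed
  define F where "F = (\<lambda>z n x. c n * (- z) ^ n * (g x ^ n * w x))"
  have intF: "integrable M (F z n)" for z n
    unfolding F_def by (intro integrable_mult_right int0)
  have F_eq: "F z n x = c n * (- (z * g x)) ^ n * w x" for z n x
  proof -
    have "(- (z * g x)) ^ n = (- z) ^ n * g x ^ n"
      by (metis mult_minus_left power_mult_distrib)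
    thus ?thesis by (simp add: F_def)
  qed
  have sumF: "summable (\<lambda>n. norm (F z n x))" for z x
  proof -
    have "norm (F z n x) = \<bar>c n * (- (z * g x)) ^ n\<bar> * \<bar>w x\<bar>" for n
      by (simp only: F_eq real_norm_def abs_mult)
    thus ?thesis using summable_mult2[OF absz[of "- (z * g x)"], of "\<bar>w x\<bar>"] by simp
  qed
  have sumI: "summable (\<lambda>n. \<integral>x. norm (F z n x) \<partial>M)" for z
  proof (rule summable_comparison_test)
    show "summable (\<lambda>n. \<bar>c n * (- z) ^ n\<bar> * (\<integral>x. norm (w x) \<partial>M))"
      by (intro summable_mult2 absz)
    have "(\<integral>x. norm (F z n x) \<partial>M) \<le> (\<integral>x. \<bar>c n * (- z) ^ n\<bar> * norm (w x) \<partial>M)" for n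
    proof (rule integral_mono)
      show "integrable M (\<lambda>x. norm (F z n x))" using intF by (rule integrable_norm)
      show "integrable M (\<lambda>x. \<bar>c n * (- z) ^ n\<bar> * norm (w x))" using w by auto
      show "norm (F z n x) \<le> \<bar>c n * (- z) ^ n\<bar> * norm (w x)" for x
        using mult_left_mono[OF le[of x n], of "\<bar>c n * (- z) ^ n\<bar>"]
        by (simp add: F_def abs_mult mult_ac)
    qed
    thus "\<exists>N. \<forall>n\<ge>N. norm (\<integral>x. norm (F z n x) \<partial>M) \<le> \<bar>c n * (- z) ^ n\<bar> * (\<integral>x. norm (w x) \<partial>M)"
      by auto
  qed
  have S: "(\<Sum>n. F z n x) = alt_series c (z * g x) * w x" for z x
  proof -
    have "summable (\<lambda>n. c n * (- (z * g x)) ^ n)" by (rule c(2))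
    thus ?thesis unfolding alt_series_def F_eq by (simp add: suminf_mult2)
  qed
  have I: "integral\<^sup>L M (F z n) = c n * (\<integral>x. g x ^ n * w x \<partial>M) * (- z) ^ n" for z n
    unfolding F_def by simp
  have sums: "(\<lambda>n. c n * (\<integral>x. g x ^ n * w x \<partial>M) * (- z) ^ n) sums
      (\<integral>x. alt_series c (z * g x) * w x \<partial>M)" for z
    using sums_integral[OF intF _ sumI, of z] sumF unfolding I S by simp
  show "(\<lambda>n. c n * (\<integral>x. g x ^ n * w x \<partial>M) * (- z) ^ n) sums
      (\<integral>x. alt_series c (z * g x) * w x \<partial>M)" by (rule sums)
  show "integrable M (\<lambda>x. alt_series c (z * g x) * w x)"
    using integrable_suminf[OF intF _ sumI, of z] sumF unfolding S by simp
  show "summable (\<lambda>n. c n * (\<integral>x. g x ^ n * w x \<partial>M) * z ^ n)"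
    using sums[of "- z"] by (simp add: sums_iff)
qed

text \<open>The new sum is an average, with weight w, of the functions z -> F(z g) with g \<ge> 0,
  each of which is nonnegative and decreasing.\<close>

lemma decreasing_alt_series_mixture:
  assumes c: "decreasing_alt_series c"
    and w: "integrable M w" "\<And>x. 0 \<le> w x" and g: "g \<in> borel_measurable M"
    and g01: "\<And>x. w x \<noteq> 0 \<Longrightarrow> 0 \<le> g x \<and> g x \<le> 1"
  shows "decreasing_alt_series (\<lambda>n. c n * (\<integral>x. g x ^ n * w x \<partial>M))"
proof -
  have c0: "0 \<le> c n" and cs: "summable (\<lambda>n. c n * z ^ n)" for n z
    using c by (auto simp: decreasing_alt_series_def)
  have mono: "0 \<le> alt_series c y" "alt_series c y \<le> alt_series c x" if "0 \<le> x" "x \<le> y" for x y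
    using c that by (auto simp: decreasing_alt_series_def)
  note mix = alt_series_power_mixture[OF c0 cs w(1) g g01]
  have eq: "alt_series (\<lambda>n. c n * (\<integral>x. g x ^ n * w x \<partial>M)) z = (\<integral>x. alt_series c (z * g x) * w x \<partial>M)" for z
    using mix(1)[of z] by (simp add: alt_series_def sums_iff)
  have pw: "0 \<le> g x ^ n * w x" for x n
    using g01[of x] w(2)[of x] by (cases "w x = 0") auto
  have le: "0 \<le> alt_series c (y * g u) * w u \<and> alt_series c (y * g u) * w u \<le> alt_series c (x * g u) * w u"
    if xy: "0 \<le> x" "x \<le> y" for x y u
  proof (cases "w u = 0")
    case False
    with g01 have "0 \<le> g u" by auto
    hence *: "0 \<le> x * g u" "x * g u \<le> y * g u" using xy by (auto intro: mult_right_mono)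
    show ?thesis using mono[OF *] w(2)[of u] by (auto intro: mult_right_mono)
  qed auto
  show ?thesis unfolding decreasing_alt_series_def eq
  proof (intro conjI allI impI)
    show "0 \<le> c n * (\<integral>x. g x ^ n * w x \<partial>M)" for n
      using c0 pw by simp
    show "summable (\<lambda>n. c n * (\<integral>x. g x ^ n * w x \<partial>M) * z ^ n)" for z
      by (rule mix(3))
    fix x y :: real assume xy: "0 \<le> x" "x \<le> y"
    show "0 \<le> (\<integral>u. alt_series c (y * g u) * w u \<partial>M)"
      using le[OF xy] by simp
    show "(\<integral>u. alt_series c (y * g u) * w u \<partial>M) \<le> (\<integral>u. alt_series c (x * g u) * w u \<partial>M)"
      by (intro integral_mono mix(2)) (use le[OF xy] in auto)
  qed
qed

section \<open>Beta mixtures, exponentials and limits\<close>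

definition beta_weight :: "real \<Rightarrow> real \<Rightarrow> real \<Rightarrow> real" where
  "beta_weight a b t = indicator {0..1} t * (t powr (a - 1) * (1 - t) powr (b - 1))"

lemma integrable_beta_weight:
  "a > 0 \<Longrightarrow> b > 0 \<Longrightarrow> integrable lborel (beta_weight a b)"
  using integrable_Beta[of a b] by (simp add: set_integrable_def beta_weight_def[abs_def])

lemma integral_beta_weight:
  assumes "a > 0" "b > 0"
  shows "(\<integral>t. beta_weight a b t \<partial>lborel) = Beta a b"
  using set_borel_integral_eq_integral(2)[OF integrable_Beta[OF assms]]
    has_integral_Beta_real[OF assms]
  by (simp add: has_integral_iff set_lebesgue_integral_def beta_weight_def[abs_def])

lemma integral_power_beta_weight:
  assumes "a > 0" "b > 0" "r \<ge> 0"
  shows "(\<integral>t. (t powr r) ^ n * beta_weight a b t \<partial>lborel) = Beta (a + r * real n) b"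
proof -
  have "(t powr r) ^ n * beta_weight a b t = beta_weight (a + r * real n) b t" for t
  proof (cases "t > 0")
    case True
    hence "(t powr r) ^ n = t powr (r * real n)"
      using powr_realpow[of "t powr r" n] by (simp add: powr_powr)
    thus ?thesis
      using powr_add[of t "r * real n" "a - 1"] by (simp add: beta_weight_def algebra_simps)
  \<comment> \<open>At t = 0 both sides vanish because \<open>0 powr\<close> anything is 0; for t <
    0 the indicator vanishes.\<close>
  qed (auto simp: beta_weight_def indicator_def)
  thus ?thesis using integral_beta_weight[of "a + r * real n" b] assms by (simp add: add_pos_nonneg)
qed

lemma Beta_add_nat:
  fixes a b :: real
  assumes "a > 0" "b > 0"
  shows "Beta (a + real n) b = Beta a b * (\<Prod>k<n. (a + real k) / (a + b + real k))"
proof (induction n)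
  case (Suc n)
  have "a + real n \<notin> \<int>\<^sub>\<le>\<^sub>0" using assms by (auto simp: nonpos_Ints_def)
  hence "(a + real n + b) * Beta (a + real n + 1) b = (a + real n) * Beta (a + real n) b"
    by (rule Beta_plus1_left)
  hence "Beta (a + real n + 1) b = Beta (a + real n) b * ((a + real n) / (a + b + real n))"
    using assms by (simp add: field_simps)
  thus ?case using Suc by (simp add: ac_simps)
qed simp

lemma Beta_real_pos: "a > 0 \<Longrightarrow> b > 0 \<Longrightarrow> Beta a b > (0::real)"
  by (simp add: Beta_def)

text \<open>The product is the n-th moment of the Beta law with parameters a and b, so this is a
  mixture with g the identity on [0,1].\<close>

lemma decreasing_alt_series_beta:
  assumes c: "decreasing_alt_series c" and ab: "a > 0" "b > 0"
  shows "decreasing_alt_series (\<lambda>n. c n * (\<Prod>k<n. (a + real k) / (a + b + real k)))"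
proof -
  define w where "w = (\<lambda>t. beta_weight a b t / Beta a b)"
  have B: "Beta a b > 0" using ab by (rule Beta_real_pos)
  have "decreasing_alt_series (\<lambda>n. c n * (\<integral>t. (t powr 1) ^ n * w t \<partial>lborel))"
  proof (rule decreasing_alt_series_mixture[OF c])
    show "integrable lborel w" unfolding w_def using integrable_beta_weight[OF ab] by simp
    show "0 \<le> w t" for t using B by (simp add: w_def beta_weight_def)
    show "0 \<le> t powr 1 \<and> t powr 1 \<le> 1" if "w t \<noteq> 0" for t
      using that by (auto simp: w_def beta_weight_def indicator_def split: if_splits)
  qed simp
  moreover have "(\<integral>t. (t powr 1) ^ n * w t \<partial>lborel) = (\<Prod>k<n. (a + real k) / (a + b + real k))" for n
    using integral_power_beta_weight[OF ab, of 1 n] Beta_add_nat[OF ab, of n] B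
    by (simp add: w_def)
  ultimately show ?thesis by simp
qed

lemma decreasing_alt_series_exp:
  assumes "K \<ge> (0::real)"
  shows "decreasing_alt_series (\<lambda>n. K ^ n / fact n)"
proof -
  have s: "(\<lambda>n. K ^ n / fact n * z ^ n) sums exp (K * z)" for z
    using exp_converges[of "K * z"] by (simp add: field_simps power_mult_distrib)
  have "alt_series (\<lambda>n. K ^ n / fact n) z = exp (- (K * z))" for z
    using s[of "- z"] by (simp add: alt_series_def sums_iff)
  thus ?thesis using assms s
    by (auto simp: decreasing_alt_series_def sums_iff mult_left_mono)
qed

text \<open>The majorant D does not depend on N, so Tannery's theorem gives pointwise convergence of
  the sums, and the weak inequalities defining the class pass to the limit.\<close>

lemma decreasing_alt_series_limit:
  assumes dec: "\<And>N. decreasing_alt_series (C N)"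
    and lim: "\<And>n. (\<lambda>N. C N n) \<longlonglongrightarrow> c n"
    and bound: "\<And>N n. C N n \<le> D n" and D: "\<And>z. summable (\<lambda>n. D n * z ^ n)"
  shows "decreasing_alt_series c"
proof -
  have C0: "0 \<le> C N n" for N n using dec by (auto simp: decreasing_alt_series_def)
  have c0: "0 \<le> c n" for n by (rule LIMSEQ_le_const[OF lim]) (use C0 in auto)
  have c_le: "c n \<le> D n" for n by (rule LIMSEQ_le_const2[OF lim]) (use bound in auto)
  have summ: "summable (\<lambda>n. c n * z ^ n)" for z
  proof (rule summable_comparison_test)
    show "summable (\<lambda>n. D n * \<bar>z\<bar> ^ n)" by (rule D)
    show "\<exists>N. \<forall>n\<ge>N. norm (c n * z ^ n) \<le> D n * \<bar>z\<bar> ^ n"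
      using c0 c_le by (auto simp: abs_mult power_abs intro!: mult_right_mono)
  qed
  have conv: "(\<lambda>N. alt_series (C N) z) \<longlonglongrightarrow> alt_series c z" for z
    unfolding alt_series_def
  proof (rule tannerys_theorem[THEN conjunct2, THEN conjunct2])
    show "((\<lambda>N. C N k * (- z) ^ k) \<longlongrightarrow> c k * (- z) ^ k) sequentially" for k
      by (intro tendsto_intros lim)
    show "summable (\<lambda>n. D n * \<bar>z\<bar> ^ n)" by (rule D)
    show "\<forall>\<^sub>F (k, N) in at_top \<times>\<^sub>F sequentially. norm (C N k * (- z) ^ k) \<le> D k * \<bar>z\<bar> ^ k"
      using C0 bound by (intro always_eventually) (auto simp: abs_mult power_abs intro!: mult_right_mono)
  qed auto
  show ?thesis unfolding decreasing_alt_series_def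
  proof (intro conjI allI impI c0 summ)
    fix x y :: real assume xy: "0 \<le> x" "x \<le> y"
    have *: "0 \<le> alt_series (C N) y" "alt_series (C N) y \<le> alt_series (C N) x" for N
      using dec[of N] xy by (auto simp: decreasing_alt_series_def)
    show "0 \<le> alt_series c y" by (rule LIMSEQ_le_const[OF conv]) (use * in auto)
    show "alt_series c y \<le> alt_series c x" by (rule LIMSEQ_le[OF conv conv]) (use * in auto)
  qed
qed

text \<open>
  A variant of Gauss's product formula for $\Gamma(x) / \Gamma(x + \alpha)$: each numerator is paired
  with the next, larger denominator, so that for $x = x_0 + k b$ every factor becomes the
  ratio of consecutive moments of a Beta distribution.
\<close>
definition gamma_ratio_approx :: "real \<Rightarrow> nat \<Rightarrow> real \<Rightarrow> real" where
  "gamma_ratio_approx \<alpha> N x =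
     real N powr (1 - \<alpha>) / x * (\<Prod>i<N. (x + \<alpha> + real i) / (x + real i + 1))"

lemma gamma_ratio_approx_tendsto:
  assumes "0 < \<alpha>" "0 < x"
  shows "(\<lambda>N. gamma_ratio_approx \<alpha> N x) \<longlonglongrightarrow> Gamma x / Gamma (x + \<alpha>)"
proof -
  have "Gamma (x + \<alpha>) > 0" using assms by (intro Gamma_real_pos) auto
  hence "Gamma (x + \<alpha>) \<noteq> 0" by simp
  hence "(\<lambda>N. Gamma_series x N / Gamma_series (x + \<alpha>) N * (real N / (x + \<alpha> + real N)))
      \<longlonglongrightarrow> Gamma x / Gamma (x + \<alpha>) * 1"
  proof (intro tendsto_intros)
    show "(\<lambda>N. real N / (x + \<alpha> + real N)) \<longlonglongrightarrow> 1" by real_asymp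
  qed auto
  moreover have "eventually (\<lambda>N. Gamma_series x N / Gamma_series (x + \<alpha>) N * (real N / (x + \<alpha> + real N))
      = gamma_ratio_approx \<alpha> N x) sequentially"
    using eventually_gt_at_top[of 0]
  proof eventually_elim
    case (elim N)
    \<comment> \<open>The first factor is split off here and the last factor in the other Pochhammer
      symbol; this creates the shifted pairing. The leftover x + \<alpha> + N is cancelled by the
      extra quotient, which tends to 1.\<close>
    have p1: "pochhammer x (N + 1) = x * (\<Prod>i<N. x + real i + 1)"
      unfolding Suc_eq_plus1[symmetric] pochhammer_rec by (simp add: pochhammer_prod atLeast0LessThan add_ac del: prod.lessThan_Suc)
    have p2: "pochhammer (x + \<alpha>) (N + 1) = (\<Prod>i<N. x + \<alpha> + real i) * (x + \<alpha> + real N)"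
      by (simp add: pochhammer_Suc pochhammer_prod atLeast0LessThan)
    have pos: "(\<Prod>i<N. x + \<alpha> + real i) > 0" "(\<Prod>i<N. x + real i + 1) > 0"
      using assms by (auto intro!: prod_pos add_pos_nonneg)
    have e: "exp (x * ln (real N)) = real N powr x" "exp ((x + \<alpha>) * ln (real N)) = real N powr (x + \<alpha>)"
      using elim by (auto simp: powr_def)
    have xx: "real N powr (1 - \<alpha>) = real N powr x / real N powr (x + \<alpha>) * real N"
      using elim by (simp add: powr_diff powr_add)
    have ee: "Gamma_series x N / Gamma_series (x + \<alpha>) N =
       real N powr x / real N powr (x + \<alpha>) * (pochhammer (x + \<alpha>) (N + 1) / pochhammer x (N + 1))"
      unfolding Gamma_series_def using elim by (simp add: e)
    have "x + \<alpha> + real N \<noteq> 0" using assms by (simp add: add_pos_nonneg)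
    thus ?case
      unfolding ee p1 p2 gamma_ratio_approx_def xx prod_dividef by (simp add: mult_ac)
  qed
  ultimately show ?thesis using Lim_transform_eventually by fastforce
qed

lemma gamma_ratio_approx_nonneg:
  "0 < \<alpha> \<Longrightarrow> 0 < x \<Longrightarrow> 0 \<le> gamma_ratio_approx \<alpha> N x"
  by (auto simp: gamma_ratio_approx_def intro!: mult_nonneg_nonneg prod_nonneg divide_nonneg_nonneg add_nonneg_nonneg)

text \<open>Supplies the majorant for the limit in N: it is independent of N and of order
  x^(-\<alpha>), hence tends to 0 along x + k b.\<close>

lemma gamma_ratio_approx_le:
  assumes "0 < \<alpha>" "\<alpha> < 1" "0 < x"
  shows "gamma_ratio_approx \<alpha> N x \<le> (x + 1) powr (1 - \<alpha>) / x"
proof -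
  \<comment> \<open>With y = x + i + 1 the left side is the i-th factor of the product, and the
    right sides telescope. The comparison is 1 - u \<le> exp(-u) followed by ln(1 + 1/y) \<le>
    1/y.\<close>
  have step: "(y - (1 - \<alpha>)) / y \<le> (y / (y + 1)) powr (1 - \<alpha>)" if y: "y > 0" for y
  proof -
    have "(y - (1 - \<alpha>)) / y = 1 + - ((1 - \<alpha>) / y)" using y by (simp add: field_simps)
    also have "\<dots> \<le> exp (- ((1 - \<alpha>) / y))" by (rule exp_ge_add_one_self)
    also have "\<dots> \<le> exp ((1 - \<alpha>) * ln (y / (y + 1)))"
    proof -
      have "ln (1 + 1 / y) \<le> 1 / y" using y by (intro ln_add_one_self_le_self) auto
      moreover have "ln (y / (y + 1)) = - ln (1 + 1 / y)"
        using y by (simp add: ln_div field_simps flip: ln_inverse)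
      ultimately have "- (1 / y) \<le> ln (y / (y + 1))" by simp
      from mult_left_mono[OF this, of "1 - \<alpha>"] show ?thesis using assms by simp
    qed
    finally show ?thesis using y by (simp add: powr_def)
  qed
  have P: "(\<Prod>i<N. (x + \<alpha> + real i) / (x + real i + 1)) \<le> ((x + 1) / (x + 1 + real N)) powr (1 - \<alpha>)"
  proof (induction N)
    case (Suc N)
    have s: "(x + \<alpha> + real N) / (x + real N + 1) \<le> ((x + 1 + real N) / (x + 1 + real (Suc N))) powr (1 - \<alpha>)"
      using step[of "x + real N + 1"] assms by (simp add: add_ac)
    have "(\<Prod>i<Suc N. (x + \<alpha> + real i) / (x + real i + 1)) \<le>
        ((x + 1) / (x + 1 + real N)) powr (1 - \<alpha>) * ((x + 1 + real N) / (x + 1 + real (Suc N))) powr (1 - \<alpha>)"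
      using mult_mono[OF Suc s] assms by simp
    also have "\<dots> = ((x + 1) / (x + 1 + real N) * ((x + 1 + real N) / (x + 1 + real (Suc N)))) powr (1 - \<alpha>)"
      using assms by (subst powr_mult) auto
    also have "(x + 1) / (x + 1 + real N) * ((x + 1 + real N) / (x + 1 + real (Suc N))) = (x + 1) / (x + 1 + real (Suc N))"
      using assms by simp
    finally show ?case .
  qed (use assms in auto)
  have "gamma_ratio_approx \<alpha> N x \<le> real N powr (1 - \<alpha>) / x * ((x + 1) / (x + 1 + real N)) powr (1 - \<alpha>)"
    unfolding gamma_ratio_approx_def using P assms by (intro mult_left_mono) auto
  also have "\<dots> = (real N * (x + 1) / (x + 1 + real N)) powr (1 - \<alpha>) / x"
    using assms by (simp add: powr_mult powr_divide)
  also have "\<dots> \<le> (x + 1) powr (1 - \<alpha>) / x"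
    using assms by (intro divide_right_mono powr_mono2) (auto simp: field_simps)
  finally show ?thesis .
qed

lemma decreasing_alt_series_gamma_ratio_approx:
  assumes \<alpha>: "0 < \<alpha>" "\<alpha> < 1" and b: "0 < b" "b < x"
  shows "decreasing_alt_series (\<lambda>n. \<Prod>k<n. gamma_ratio_approx \<alpha> N (x + real k * b))"
proof -
  have iter: "decreasing_alt_series (\<lambda>n. c n * (\<Prod>k<n. \<Prod>i<N. (x + real k * b + \<alpha> + real i) / (x + real k * b + real i + 1)))"
    if c: "decreasing_alt_series c" for c N
  proof (induction N)
    case (Suc N)
    \<comment> \<open>Division by b turns the progression in k into one of step 1, which exhibits
      the Beta parameters (x + \<alpha> + N)/b and (1 - \<alpha>)/b.\<close>
    have eq: "((x + \<alpha> + real N) / b + real k) / ((x + \<alpha> + real N) / b + (1 - \<alpha>) / b + real k)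
        = (x + real k * b + \<alpha> + real N) / (x + real k * b + real N + 1)" for k
    proof -
      have "(x + \<alpha> + real N) / b + (1 - \<alpha>) / b + real k = (x + real k * b + real N + 1) / b"
        "(x + \<alpha> + real N) / b + real k = (x + real k * b + \<alpha> + real N) / b"
        using b by (auto simp: field_simps)
      thus ?thesis using b by simp
    qed
    have split: "(\<Prod>k<n. \<Prod>i<Suc N. (x + real k * b + \<alpha> + real i) / (x + real k * b + real i + 1)) =
        (\<Prod>k<n. \<Prod>i<N. (x + real k * b + \<alpha> + real i) / (x + real k * b + real i + 1)) *
        (\<Prod>k<n. (x + real k * b + \<alpha> + real N) / (x + real k * b + real N + 1))" for n
      by (simp only: prod.lessThan_Suc prod.distrib)
    have "0 < (x + \<alpha> + real N) / b" "0 < (1 - \<alpha>) / b" using \<alpha> b by auto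
    from decreasing_alt_series_beta[OF Suc this] show ?case
      unfolding eq split by (simp only: mult.assoc)
  qed (use c in simp)
  define K where "K = real N powr (1 - \<alpha>) / b"
  have K: "K \<ge> 0" using b by (simp add: K_def)
  \<comment> \<open>The prefactors 1/(x + k b) remain. After scaling by b their product is 1/n!
    times a Beta moment with parameters 1 and x/b - 1, so it comes from an exponential; positivity
    of x/b - 1 is the condition b < x.\<close>
  define c where "c = (\<lambda>n. K ^ n / fact n * (\<Prod>k<n. (1 + real k) / (1 + (x / b - 1) + real k)))"
  have "decreasing_alt_series c" unfolding c_def
    by (rule decreasing_alt_series_beta[OF decreasing_alt_series_exp[OF K]]) (use b in auto)
  note iter[OF this, of N]
  moreover have "c n = (\<Prod>k<n. real N powr (1 - \<alpha>) / (x + real k * b))" for n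
  proof -
    have "c n = (\<Prod>k<n. K / (1 + real k) * ((1 + real k) / (x / b + real k)))"
      unfolding c_def by (simp add: prod.distrib prod_dividef fact_prod_Suc atLeast0LessThan)
    also have "\<dots> = (\<Prod>k<n. real N powr (1 - \<alpha>) / (x + real k * b))"
    proof (rule prod.cong)
      fix k
      have "x / b + real k = (x + real k * b) / b" using b by (simp add: field_simps)
      moreover have "1 + real k \<noteq> 0" by linarith
      ultimately show "K / (1 + real k) * ((1 + real k) / (x / b + real k)) = real N powr (1 - \<alpha>) / (x + real k * b)"
        using b unfolding K_def by simp
    qed simp
    finally show ?thesis .
  qed
  ultimately show ?thesis
    unfolding gamma_ratio_approx_def prod.distrib by (simp only: )
qed

lemma summable_prod_tendsto_0:
  fixes d :: "nat \<Rightarrow> real"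
  assumes d: "d \<longlonglongrightarrow> 0"
  shows "summable (\<lambda>n. (\<Prod>k<n. d k) * z ^ n)"
proof -
  have "(\<lambda>k. \<bar>d k * z\<bar>) \<longlonglongrightarrow> 0"
    using tendsto_rabs_zero[OF tendsto_mult_left_zero[OF d, of z]] .
  hence "eventually (\<lambda>k. \<bar>d k * z\<bar> < 1 / 2) sequentially"
    by (rule order_tendstoD) simp
  then obtain N where N: "\<And>k. k \<ge> N \<Longrightarrow> \<bar>d k * z\<bar> < 1 / 2"
    by (auto simp: eventually_at_top_linorder)
  show ?thesis
  proof (rule summable_ratio_test[of "1 / 2" N])
    fix n assume "n \<ge> N"
    have "norm ((\<Prod>k<Suc n. d k) * z ^ Suc n) = \<bar>d n * z\<bar> * norm ((\<Prod>k<n. d k) * z ^ n)"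
      by (simp add: abs_mult mult_ac)
    also have "\<dots> \<le> 1 / 2 * norm ((\<Prod>k<n. d k) * z ^ n)"
      using N[OF \<open>n \<ge> N\<close>] by (intro mult_right_mono) auto
    finally show "norm ((\<Prod>k<Suc n. d k) * z ^ Suc n) \<le> 1 / 2 * norm ((\<Prod>k<n. d k) * z ^ n)" .
  qed simp
qed

lemma decreasing_alt_series_gamma_ratio:
  assumes \<alpha>: "0 < \<alpha>" "\<alpha> < 1" and b: "0 < b" "b < x"
  shows "decreasing_alt_series (\<lambda>n. \<Prod>k<n. Gamma (x + real k * b) / Gamma (x + real k * b + \<alpha>))"
proof (rule decreasing_alt_series_limit)
  have pos: "0 < x + real k * b" for k using b by (intro add_pos_nonneg) auto
  show "decreasing_alt_series (\<lambda>n. \<Prod>k<n. gamma_ratio_approx \<alpha> N (x + real k * b))" for N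
    by (rule decreasing_alt_series_gamma_ratio_approx[OF assms])
  show "(\<lambda>N. \<Prod>k<n. gamma_ratio_approx \<alpha> N (x + real k * b)) \<longlonglongrightarrow>
      (\<Prod>k<n. Gamma (x + real k * b) / Gamma (x + real k * b + \<alpha>))" for n
    by (intro tendsto_prod gamma_ratio_approx_tendsto \<alpha> pos)
  show "(\<Prod>k<n. gamma_ratio_approx \<alpha> N (x + real k * b)) \<le>
      (\<Prod>k<n. (x + real k * b + 1) powr (1 - \<alpha>) / (x + real k * b))" for N n
    by (intro prod_mono conjI gamma_ratio_approx_nonneg gamma_ratio_approx_le \<alpha> pos)
  show "summable (\<lambda>n. (\<Prod>k<n. (x + real k * b + 1) powr (1 - \<alpha>) / (x + real k * b)) * z ^ n)" for z
    by (rule summable_prod_tendsto_0) (use \<alpha> b in real_asymp)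
qed

text \<open>
  The coefficients $c_n$ satisfy $\Gamma(\alpha) c_{n+1} = B(x + n b, \alpha) c_n$, which turns the series $F$
  into a solution of $1 - F(z) = z / \Gamma(\alpha) \int_0^1 F(z t^b) t^{x-1} (1-t)^{\alpha-1} dt$;
  by monotonicity the integral is at least $F(z) B(x, \alpha)$.
\<close>
lemma alt_series_gamma_ratio_le:
  assumes \<alpha>: "0 < \<alpha>" "\<alpha> < 1" and b: "0 < b" "b < x" and z: "0 < z"
  shows "alt_series (\<lambda>n. \<Prod>k<n. Gamma (x + real k * b) / Gamma (x + real k * b + \<alpha>)) z
           \<le> Gamma (x + \<alpha>) / Gamma x / z"
proof -
  define c where "c = (\<lambda>n. \<Prod>k<n. Gamma (x + real k * b) / Gamma (x + real k * b + \<alpha>))"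
  have dec: "decreasing_alt_series c"
    unfolding c_def by (rule decreasing_alt_series_gamma_ratio[OF \<alpha> b])
  have c0: "0 \<le> c n" and cs: "summable (\<lambda>n. c n * z ^ n)" for n z
    using dec by (auto simp: decreasing_alt_series_def)
  have x: "x > 0" using b by simp
  have g01: "0 \<le> t powr b \<and> t powr b \<le> 1" if "beta_weight x \<alpha> t \<noteq> 0" for t
    using that b by (auto simp: beta_weight_def indicator_def powr_le1 split: if_splits)
  have w0: "0 \<le> beta_weight x \<alpha> t" for t by (simp add: beta_weight_def)
  have meas: "(\<lambda>t. t powr b) \<in> borel_measurable lborel" by simp
  note mix = alt_series_power_mixture[OF c0 cs integrable_beta_weight[OF x \<alpha>(1)]
      meas g01]
  let ?I = "\<integral>t. alt_series c (z * t powr b) * beta_weight x \<alpha> t \<partial>lborel"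
  have coeff: "c n * (\<integral>t. (t powr b) ^ n * beta_weight x \<alpha> t \<partial>lborel) = Gamma \<alpha> * c (Suc n)" for n
    using integral_power_beta_weight[OF x \<alpha>(1), of b n] b
    by (simp add: c_def Beta_def mult_ac)
  have "(\<lambda>n. Gamma \<alpha> * c (Suc n) * (- z) ^ n) sums ?I"
    using mix(1)[where z = z] unfolding coeff by simp
  from sums_mult[OF this, of "- z / Gamma \<alpha>"]
  have "(\<lambda>n. c (Suc n) * (- z) ^ Suc n) sums (- z / Gamma \<alpha> * ?I)"
    using Gamma_real_pos[OF \<alpha>(1)] by (simp add: mult_ac)
  \<comment> \<open>The constant term is removed: \<open>c 0\<close> is an empty product, hence
    1.\<close>
  moreover have "(\<lambda>n. c (Suc n) * (- z) ^ Suc n) sums (alt_series c z - 1)"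
    using summable_sums[OF cs[of "- z"]]
    by (subst sums_Suc_iff) (simp add: alt_series_def, simp add: c_def)
  ultimately have eq: "1 - alt_series c z = z / Gamma \<alpha> * ?I"
    using sums_unique2 by fastforce
  have mono: "alt_series c z \<le> alt_series c (z * t)" if "0 \<le> t" "t \<le> 1" for t
  proof -
    have "0 \<le> z * t" "z * t \<le> z"
      using that z by (auto simp: mult_left_le)
    thus ?thesis using dec unfolding decreasing_alt_series_def by blast
  qed
  have "alt_series c z * Beta x \<alpha> = (\<integral>t. alt_series c z * beta_weight x \<alpha> t \<partial>lborel)"
    using integral_beta_weight[OF x \<alpha>(1)] by simp
  also have "\<dots> \<le> ?I"
  proof (rule integral_mono)
    show "alt_series c z * beta_weight x \<alpha> t \<le> alt_series c (z * t powr b) * beta_weight x \<alpha> t" for t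
    proof (cases "beta_weight x \<alpha> t = 0")
      case False
      thus ?thesis using g01[OF False] w0 by (intro mult_right_mono mono) auto
    qed simp
  qed (use integrable_beta_weight[OF x \<alpha>(1)] mix(2)[where z = z] in auto)
  finally have "z / Gamma \<alpha> * (alt_series c z * Beta x \<alpha>) \<le> 1 - alt_series c z"
    unfolding eq using z Gamma_real_pos[OF \<alpha>(1)] by (intro mult_left_mono) auto
  also have "\<dots> \<le> 1"
  proof -
    have "0 \<le> z" using z by simp
    thus ?thesis using dec unfolding decreasing_alt_series_def by (simp only: diff_le_eq) auto
  qed
  \<comment> \<open>Here B(x,\<alpha>) / Gamma(\<alpha>) = Gamma(x) / Gamma(x+\<alpha>), which gives
    the constant.\<close>
  finally show ?thesis
    using z Gamma_real_pos[OF \<alpha>(1)] Gamma_real_pos[OF x] Gamma_real_pos[of "x + \<alpha>"] x \<alpha>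
    unfolding c_def[symmetric] by (simp add: Beta_def field_simps)
qed

text \<open>For these parameters the Gamma arguments run through the progression x + k b with x = 1
  + \<gamma> and b = \<alpha> + \<gamma>; the condition b < x then reads \<alpha> < 1.\<close>

lemma kilbas_saigo_bounds:
  assumes "0 < \<alpha>" "\<alpha> < 1" "0 \<le> \<gamma>" "\<alpha> + \<gamma> \<le> 1" "0 < z"
  shows "0 \<le> kilbas_saigo \<alpha> (1 + \<gamma> / \<alpha>) (\<gamma> / \<alpha>) (- z)"
    and "kilbas_saigo \<alpha> (1 + \<gamma> / \<alpha>) (\<gamma> / \<alpha>) (- z) \<le> Gamma (1 + \<gamma> + \<alpha>) / Gamma (1 + \<gamma>) / z"
proof -
  define c where "c = (\<lambda>n. \<Prod>k<n. Gamma (1 + \<gamma> + real k * (\<alpha> + \<gamma>)) / Gamma (1 + \<gamma> + real k * (\<alpha> + \<gamma>) + \<alpha>))"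
  have "kilbas_saigo_coeff \<alpha> (1 + \<gamma> / \<alpha>) (\<gamma> / \<alpha>) n = c n" for n
  proof -
    have "1 + \<alpha> * (real k * (1 + \<gamma> / \<alpha>) + \<gamma> / \<alpha>) = 1 + \<gamma> + real k * (\<alpha> + \<gamma>)"
      "1 + \<alpha> * (real k * (1 + \<gamma> / \<alpha>) + \<gamma> / \<alpha> + 1) = 1 + \<gamma> + real k * (\<alpha> + \<gamma>) + \<alpha>" for k
      using assms by (auto simp: field_simps)
    thus ?thesis by (simp only: kilbas_saigo_coeff_def c_def)
  qed
  hence eq: "kilbas_saigo \<alpha> (1 + \<gamma> / \<alpha>) (\<gamma> / \<alpha>) (- z) = alt_series c z"
    by (simp add: kilbas_saigo_def alt_series_def)
  have "decreasing_alt_series c" unfolding c_def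
    by (rule decreasing_alt_series_gamma_ratio) (use assms in auto)
  thus "0 \<le> kilbas_saigo \<alpha> (1 + \<gamma> / \<alpha>) (\<gamma> / \<alpha>) (- z)"
    unfolding eq using assms by (auto simp: decreasing_alt_series_def)
  show "kilbas_saigo \<alpha> (1 + \<gamma> / \<alpha>) (\<gamma> / \<alpha>) (- z) \<le> Gamma (1 + \<gamma> + \<alpha>) / Gamma (1 + \<gamma>) / z"
    unfolding eq c_def by (rule alt_series_gamma_ratio_le) (use assms in auto)
qed

section \<open>Pointwise decay of orthonormal Hermite polynomials\<close>

definition std_normal_expectation :: "real poly \<Rightarrow> real" where
  "std_normal_expectation p = (\<integral>x. poly p x * std_normal_density x \<partial>lborel)"

lemma integrable_poly_std_normal: "integrable lborel (\<lambda>x. poly p x * std_normal_density x)"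
proof -
  have eq: "(\<lambda>x. poly p x * std_normal_density x) = (\<lambda>x. \<Sum>i\<le>degree p. coeff p i * (std_normal_density x * x ^ i))"
    by (simp add: poly_altdef sum_distrib_left sum_distrib_right mult_ac fun_eq_iff)
  show ?thesis unfolding eq
    using integrable_std_normal_moment by (intro Bochner_Integration.integrable_sum integrable_mult_right) auto
qed

lemma std_normal_expectation_add:
  "std_normal_expectation (p + q) = std_normal_expectation p + std_normal_expectation q"
  using integrable_poly_std_normal[of p] integrable_poly_std_normal[of q]
  by (simp add: std_normal_expectation_def algebra_simps)

lemma std_normal_expectation_smult:
  "std_normal_expectation (smult c p) = c * std_normal_expectation p"
  by (simp add: std_normal_expectation_def mult.assoc)

lemma std_normal_expectation_diff:
  "std_normal_expectation (p - q) = std_normal_expectation p - std_normal_expectation q"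
  using integrable_poly_std_normal[of p] integrable_poly_std_normal[of q]
  by (simp add: std_normal_expectation_def algebra_simps)

lemma std_normal_expectation_0 [simp]: "std_normal_expectation 0 = 0"
  by (simp add: std_normal_expectation_def)

lemma std_normal_expectation_1 [simp]: "std_normal_expectation 1 = 1"
  by (simp add: std_normal_expectation_def)

lemma std_normal_expectation_sum:
  "std_normal_expectation (\<Sum>i\<in>A. p i) = (\<Sum>i\<in>A. std_normal_expectation (p i))"
  by (induction A rule: infinite_finite_induct) (auto simp: std_normal_expectation_add)

lemma std_normal_moment_rec:
  "(\<integral>x. std_normal_density x * x ^ Suc k \<partial>lborel) = real k * (\<integral>x. std_normal_density x * x ^ (k - 1) \<partial>lborel)"
proof (cases "even k")
  case True
  then obtain j where k: "k = 2 * j" by blast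
  show ?thesis
  proof (cases j)
    \<comment> \<open>The truncated k - 1 is harmless: its factor k is 0, and the left side is an
      odd moment.\<close>
    case 0 thus ?thesis using integral_std_normal_moment_odd[of 0] k by simp
  next
    case (Suc i)
    have "k - 1 = 2 * i + 1" "Suc k = 2 * j + 1" using Suc k by auto
    thus ?thesis using integral_std_normal_moment_odd[of i] integral_std_normal_moment_odd[of j] by simp
  qed
next
  case False
  then obtain j where k: "k = 2 * j + 1" using oddE by blast
  have S: "Suc k = 2 * Suc j" "k - 1 = 2 * j" using k by auto
  have "fact (2 * Suc j) / (2 ^ Suc j * fact (Suc j)) = real k * (fact (2 * j) / (2 ^ j * fact j))"
    by (simp add: k divide_simps)
  thus ?thesis unfolding S integral_std_normal_moment_even .
qed

lemma std_normal_expectation_monom: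
  "std_normal_expectation (monom c k) = c * (\<integral>x. std_normal_density x * x ^ k \<partial>lborel)"
  by (simp add: std_normal_expectation_def poly_monom mult_ac)

text \<open>Gaussian integration by parts. By linearity it suffices to treat monomials, where it is
  the moment recursion, so no boundary terms arise.\<close>

lemma std_normal_expectation_ibp:
  "std_normal_expectation ([:0, 1:] * p) = std_normal_expectation (pderiv p)"
proof -
  have m: "std_normal_expectation ([:0, 1:] * monom c k) = std_normal_expectation (pderiv (monom c k))" for c k
  proof -
    have "[:0, 1:] * monom c k = monom c (Suc k)" by (simp add: monom_Suc)
    thus ?thesis by (simp add: pderiv_monom std_normal_expectation_monom std_normal_moment_rec del: power_Suc)
  qed
  have "std_normal_expectation ([:0, 1:] * (\<Sum>i\<in>A. monom (coeff p i) i)) =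
      std_normal_expectation (pderiv (\<Sum>i\<in>A. monom (coeff p i) i))" for A
    using higher_pderiv_sum[of 1 "\<lambda>i. monom (coeff p i) i" A]
    by (simp only: sum_distrib_left funpow.simps One_nat_def comp_def id_apply std_normal_expectation_sum m)
  from this[of "{..degree p}"] show ?thesis by (simp only: poly_as_sum_of_monoms)
qed

text \<open>The probabilists' Hermite polynomials, built by the raising operator x - d/dx, which is
  the adjoint of d/dx for the Gaussian weight.\<close>

fun hermite :: "nat \<Rightarrow> real poly" where
  "hermite 0 = 1"
| "hermite (Suc n) = [:0, 1:] * hermite n - pderiv (hermite n)"

lemma pderiv_hermite: "pderiv (hermite (Suc n)) = smult (real (Suc n)) (hermite n)"
proof (induction n)
  case 0 thus ?case by (simp add: pderiv_pCons)
next
  case (Suc n)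
  have "pderiv (hermite (Suc (Suc n))) =
      hermite (Suc n) + [:0, 1:] * pderiv (hermite (Suc n)) - pderiv (pderiv (hermite (Suc n)))"
    by (simp only: hermite.simps(2)[of "Suc n"] pderiv_diff pderiv_mult) (simp add: pderiv_pCons)
  also have "\<dots> = hermite (Suc n) + smult (real (Suc n)) ([:0, 1:] * hermite n - pderiv (hermite n))"
    by (simp only: Suc pderiv_smult smult_diff_right mult_smult_right add_diff_eq)
  also have "\<dots> = hermite (Suc n) + smult (real (Suc n)) (hermite (Suc n))"
    by (simp only: hermite.simps(2)[of n])
  also have "\<dots> = smult (real (Suc (Suc n))) (hermite (Suc n))"
    by (simp only: of_nat_Suc[of "Suc n"] smult_add_left smult_1_left)
  finally show ?case .
qed

lemma degree_hermite_le: "degree (hermite n) \<le> n"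
proof (induction n)
  case (Suc n)
  have "degree ([:0, 1:] * hermite n) \<le> 1 + degree (hermite n)"
    using degree_mult_le[of "[:0, 1:]" "hermite n"] by simp
  moreover have "degree (pderiv (hermite n)) \<le> degree (hermite n)" by (simp add: degree_pderiv)
  ultimately show ?case using Suc by (auto intro!: degree_diff_le)
qed simp

lemma std_normal_expectation_hermite_Suc:
  "std_normal_expectation (hermite (Suc n) * p) = std_normal_expectation (hermite n * pderiv p)"
proof -
  have "hermite (Suc n) * p = [:0, 1:] * (hermite n * p) - pderiv (hermite n) * p"
    by (simp add: algebra_simps)
  moreover have "pderiv (hermite n * p) = hermite n * pderiv p + pderiv (hermite n) * p"
    by (simp add: pderiv_mult)
  ultimately show ?thesis
    by (simp only: std_normal_expectation_diff std_normal_expectation_ibp std_normal_expectation_add add_diff_cancel_right')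
qed

text \<open>Each lowering of the index moves one derivative onto p, and p is exhausted before the
  index is.\<close>

lemma hermite_orthogonal: "degree p < n \<Longrightarrow> std_normal_expectation (hermite n * p) = 0"
proof (induction n arbitrary: p)
  case (Suc n)
  show ?case
  proof (cases "degree p = 0")
    case True
    hence "pderiv p = 0" by (simp add: pderiv_eq_0_iff)
    thus ?thesis by (simp only: std_normal_expectation_hermite_Suc) simp
  next
    case False
    hence "degree (pderiv p) < n" using Suc.prems by (simp add: degree_pderiv)
    thus ?thesis using Suc.IH by (simp only: std_normal_expectation_hermite_Suc)
  qed
qed simp

lemma hermite_norm: "std_normal_expectation (hermite n * hermite n) = fact n"
proof (induction n)
  case (Suc n)
  thus ?case
    by (simp only: std_normal_expectation_hermite_Suc pderiv_hermite mult_smult_right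
      std_normal_expectation_smult fact_Suc)
qed simp

section \<open>Identification of orthonormal polynomials up to sign\<close>

lemma orthonormal_polynomials_span:
  assumes Q: "orthonormal_polynomials w Q" and "degree p \<le> n"
  shows "\<exists>d. p = (\<Sum>i\<le>n. smult (d i) (Q i))"
  using assms(2)
proof (induction n arbitrary: p)
  case 0
  have "degree (Q 0) = 0" using Q by (simp add: orthonormal_polynomials_def)
  then obtain k where k: "Q 0 = [:k:]" using degree_eq_zeroE by metis
  \<comment> \<open>Degree 0 also admits the zero polynomial; the norm 1 excludes it.\<close>
  have "has_bochner_integral lborel (\<lambda>x. poly (Q 0) x * poly (Q 0) x * w x) (if 0 = (0::nat) then 1 else 0)"
    using Q unfolding orthonormal_polynomials_def by blast
  hence "k \<noteq> 0" using k by (auto simp: has_bochner_integral_iff)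
  moreover obtain e where "p = [:e:]" using 0 degree_eq_zeroE by (metis le_0_eq)
  ultimately have "p = (\<Sum>i\<le>0. smult (e / k) (Q i))" using k by simp
  thus ?case by (intro exI[of _ "\<lambda>_. e / k"])
next
  case (Suc n)
  have deg: "degree (Q (Suc n)) = Suc n" using Q by (simp add: orthonormal_polynomials_def)
  hence nz: "coeff (Q (Suc n)) (Suc n) \<noteq> 0" by (metis leading_coeff_0_iff degree_0 nat.distinct(1))
  define e where "e = coeff p (Suc n) / coeff (Q (Suc n)) (Suc n)"
  have "degree (p - smult e (Q (Suc n))) \<le> n"
  proof (rule degree_le, intro allI impI)
    fix i assume i: "i > n"
    show "coeff (p - smult e (Q (Suc n))) i = 0"
    proof (cases "i = Suc n")
      case True thus ?thesis using nz by (simp add: e_def)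
    next
      case False
      with i have "i > Suc n" by simp
      thus ?thesis using Suc.prems deg by (simp add: coeff_eq_0)
    qed
  qed
  then obtain d where "p - smult e (Q (Suc n)) = (\<Sum>i\<le>n. smult (d i) (Q i))" using Suc.IH by blast
  hence "p = (\<Sum>i\<le>Suc n. smult ((d(Suc n := e)) i) (Q i))"
    by (simp add: algebra_simps)
  thus ?case by blast
qed

text \<open>In the expansion of \<open>hermite n\<close> in the Q_i, orthogonality to lower degrees
  leaves only the top term, and the norm n! fixes its coefficient up to sign. The sign of Q_n is
  free, hence the absolute values.\<close>

lemma orthonormal_polynomials_std_normal:
  assumes Q: "orthonormal_polynomials std_normal_density Q"
  shows "\<bar>poly (Q n) x\<bar> = \<bar>poly (hermite n) x\<bar> / sqrt (fact n)"
proof -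
  have QQ: "std_normal_expectation (Q i * Q j) = (if i = j then 1 else 0)" for i j
    using Q by (simp add: orthonormal_polynomials_def has_bochner_integral_iff std_normal_expectation_def)
  obtain d where d: "hermite n = (\<Sum>i\<le>n. smult (d i) (Q i))"
    using orthonormal_polynomials_span[OF Q degree_hermite_le] by blast
  have coef: "std_normal_expectation (hermite n * Q j) = d j" if "j \<le> n" for j
    unfolding d sum_distrib_right mult_smult_left std_normal_expectation_sum
      std_normal_expectation_smult QQ
    using that by (simp add: if_distrib cong: if_cong)
  have "d j = 0" if "j < n" for j
  proof -
    have "degree (Q j) < n" using Q that by (simp add: orthonormal_polynomials_def)
    thus ?thesis using hermite_orthogonal coef[of j] that by simp
  qed
  hence "hermite n = (\<Sum>i\<le>n. if i = n then smult (d n) (Q n) else 0)"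
    unfolding d by (intro sum.cong) auto
  hence H: "hermite n = smult (d n) (Q n)" by simp
  have "fact n = d n * d n"
    using hermite_norm[of n] unfolding H
    by (simp add: std_normal_expectation_smult QQ)
  hence "\<bar>d n\<bar> = sqrt (fact n)" by (metis real_sqrt_abs2)
  thus ?thesis unfolding H by (simp add: abs_mult)
qed

section \<open>Decay from the three-term recurrence\<close>

lemma hermite_rec:
  "poly (hermite (Suc (Suc n))) x = x * poly (hermite (Suc n)) x - real (Suc n) * poly (hermite n) x"
  by (simp only: hermite.simps(2)[of "Suc n"] pderiv_hermite) simp

lemma normalized_hermite_rec:
  fixes x :: real
  defines "q \<equiv> \<lambda>n. poly (hermite n) x / sqrt (fact n)"
  shows "sqrt (real n + 2) * q (Suc (Suc n)) = x * q (Suc n) - sqrt (real n + 1) * q n"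
proof -
  have f: "sqrt (fact (Suc m)) = sqrt (real m + 1) * sqrt (fact m)" for m :: nat
    by (simp add: real_sqrt_mult add.commute)
  have p: "sqrt (real n + 2) > 0" "sqrt (real n + 1) > 0" "sqrt (fact n) > 0"
    "sqrt (real n + 1) * sqrt (real n + 1) = real n + 1" by auto
  have "sqrt (real n + 2) * q (Suc (Suc n)) =
      poly (hermite (Suc (Suc n))) x / (sqrt (real n + 1) * sqrt (fact n))"
    using f[of "Suc n"] p unfolding q_def f[of n] by (simp add: add.commute del: hermite.simps fact_Suc)
  also have "\<dots> = x * q (Suc n) - (sqrt (real n + 1) * sqrt (real n + 1)) * poly (hermite n) x / (sqrt (real n + 1) * sqrt (fact n))"
    unfolding hermite_rec q_def f[of n] p(4)
    by (simp add: diff_divide_distrib add.commute del: hermite.simps)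
  also have "\<dots> = x * q (Suc n) - sqrt (real n + 1) * q n"
  proof -
    have "r * r * A / (r * B) = r * (A / B)" if "r > 0" for r A B :: real using that by simp
    from this[OF p(2)] show ?thesis unfolding q_def by (simp only: )
  qed
  finally show ?thesis .
qed

text \<open>
  The energy $W_n = \sqrt{n+2} q_{n+1}^2 + \sqrt{n+1} q_n^2 - x \sqrt{(n+2)/(n+1)} q_{n+1} q_n$ is almost
  conserved by the recurrence: the coefficient of $q_n^2$ in $W_{n+1} - W_n$ is negative, the squares
  of $q_{n+1}$ cancel, and the cross term is of relative size $n^{-3/2}$, which is summable.
\<close>
lemma three_term_decay:
  fixes q :: "nat \<Rightarrow> real" and x :: real
  assumes rec: "\<And>n. sqrt (real n + 2) * q (Suc (Suc n)) = x * q (Suc n) - sqrt (real n + 1) * q n"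
  shows "\<exists>C. eventually (\<lambda>n. \<bar>q n\<bar> \<le> C * real n powr (- 1 / 4)) sequentially"
proof -
  define W where "W = (\<lambda>n. sqrt (real n + 2) * (q (Suc n))\<^sup>2 + sqrt (real n + 1) * (q n)\<^sup>2
      - x * sqrt ((real n + 2) / (real n + 1)) * (q (Suc n) * q n))"
  \<comment> \<open>x \<open>b n\<close> is the cross coefficient left in W_(n+1) - W_n after
    q_(n+2) is eliminated. Both roots lie within 1/(n+1) of 1, on opposite sides.\<close>
  define b where "b = (\<lambda>n. sqrt ((real n + 2) / (real n + 1)) - sqrt ((real n + 1) * (real n + 3)) / (real n + 2))"
  have b: "0 \<le> b n" "b n \<le> 2 / (real n + 1)" for n
  proof -
    have s1: "1 \<le> sqrt ((real n + 2) / (real n + 1))" by simp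
    have "sqrt ((real n + 1) * (real n + 3)) \<le> sqrt ((real n + 2)\<^sup>2)"
      by (intro real_sqrt_le_mono) (simp add: power2_eq_square algebra_simps)
    hence s2: "sqrt ((real n + 1) * (real n + 3)) / (real n + 2) \<le> 1" by simp
    show "0 \<le> b n" using order_trans[OF s2 s1] unfolding b_def by linarith
    have "(real n + 2) / (real n + 1) = 1 + 1 / (real n + 1)" by (simp add: field_simps)
    also have "\<dots> \<le> (1 + 1 / (real n + 1))\<^sup>2" by (rule self_le_power) auto
    finally have s3: "sqrt ((real n + 2) / (real n + 1)) \<le> 1 + 1 / (real n + 1)"
      by (intro real_le_lsqrt) auto
    have "sqrt ((real n + 1)\<^sup>2) \<le> sqrt ((real n + 1) * (real n + 3))"
      by (intro real_sqrt_le_mono) (simp add: power2_eq_square algebra_simps)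
    hence "(real n + 1) / (real n + 2) \<le> sqrt ((real n + 1) * (real n + 3)) / (real n + 2)"
      by (intro divide_right_mono) auto
    moreover have "1 - 1 / (real n + 1) \<le> (real n + 1) / (real n + 2)" by (simp add: field_simps)
    ultimately show "b n \<le> 2 / (real n + 1)" using s3 by (simp add: b_def)
  qed
  have step: "W (Suc n) \<le> W n + x * b n * (q (Suc n) * q n)" for n
  proof -
    define r s t u where "r = sqrt (real n + 1)" and "s = sqrt (real n + 2)"
      and "t = sqrt (real n + 3)" and "u = q (Suc (Suc n))"
    have pos: "r > 0" "s > 0" "t > 0" by (auto simp: r_def s_def t_def)
    have sq: "r\<^sup>2 = real n + 1" "s\<^sup>2 = real n + 2" by (auto simp: r_def s_def)
    \<comment> \<open>Arithmetic-geometric mean inequality for n+1 and n+3; it makes the coefficient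
      of q_n^2 in the difference nonpositive.\<close>
    have "r * t \<le> s\<^sup>2"
    proof (rule power2_le_imp_le)
      have "(r * t)\<^sup>2 = (real n + 1) * (real n + 3)" by (simp add: r_def t_def power_mult_distrib)
      also have "\<dots> \<le> (real n + 2)\<^sup>2" by (simp add: power2_eq_square algebra_simps)
      finally show "(r * t)\<^sup>2 \<le> (s\<^sup>2)\<^sup>2" by (simp add: sq)
    qed simp
    hence "r * (r * t) \<le> r * s\<^sup>2" using pos by (intro mult_left_mono) auto
    hence tr: "t * r\<^sup>2 / s\<^sup>2 \<le> r" using pos by (simp add: field_simps power2_eq_square)
    have su: "s * u = x * q (Suc n) - r * q n" using rec[of n] by (simp add: r_def s_def u_def)
    have u: "u = (x * q (Suc n) - r * q n) / s" using su pos by (simp add: field_simps)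
    have W1: "W (Suc n) = t * u\<^sup>2 + s * (q (Suc n))\<^sup>2 - x * (t / s) * (u * q (Suc n))"
      by (simp add: W_def t_def s_def u_def real_sqrt_divide add_ac)
    have W0: "W n = s * (q (Suc n))\<^sup>2 + r * (q n)\<^sup>2 - x * (s / r) * (q (Suc n) * q n)"
      by (simp add: W_def r_def s_def real_sqrt_divide)
    have bn: "b n = s / r - r * t / s\<^sup>2"
      by (simp add: b_def sq real_sqrt_divide real_sqrt_mult) (simp add: r_def s_def t_def)
    have "W (Suc n) - (W n + x * b n * (q (Suc n) * q n)) = (t * r\<^sup>2 / s\<^sup>2 - r) * (q n)\<^sup>2"
      unfolding W1 W0 bn u using pos by (simp add: field_simps power2_eq_square)
    also have "\<dots> \<le> 0" using tr by (intro mult_nonpos_nonneg) auto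
    finally show ?thesis by simp
  qed
  \<comment> \<open>From this index on, |x| sqrt((n+2)/(n+1)) \<le> sqrt(2 x^2) \<le> sqrt(n+1), so
    the cross term can absorb at most half of the squares and W controls them.\<close>
  obtain n0 where n0: "real n0 \<ge> 2 * x\<^sup>2" using real_arch_simple by blast
  have lower: "sqrt (real n + 1) / 2 * ((q (Suc n))\<^sup>2 + (q n)\<^sup>2) \<le> W n" if n: "n \<ge> n0" for n
  proof -
    have "\<bar>x\<bar> * sqrt ((real n + 2) / (real n + 1)) \<le> \<bar>x\<bar> * sqrt 2"
      by (intro mult_left_mono) (auto simp: field_simps)
    also have "\<dots> = sqrt (2 * x\<^sup>2)" by (simp add: real_sqrt_mult)
    also have "\<dots> \<le> sqrt (real n + 1)" using n n0 by simp
    finally have k: "\<bar>x\<bar> * sqrt ((real n + 2) / (real n + 1)) \<le> sqrt (real n + 1)" .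
    have am: "\<bar>q (Suc n) * q n\<bar> \<le> ((q (Suc n))\<^sup>2 + (q n)\<^sup>2) / 2"
      using sum_squares_bound[of "\<bar>q (Suc n)\<bar>" "\<bar>q n\<bar>"] by (simp add: abs_mult)
    have "x * sqrt ((real n + 2) / (real n + 1)) * (q (Suc n) * q n)
        \<le> \<bar>x * sqrt ((real n + 2) / (real n + 1))\<bar> * \<bar>q (Suc n) * q n\<bar>"
      by (metis abs_ge_self abs_mult)
    also have "\<dots> \<le> sqrt (real n + 1) * (((q (Suc n))\<^sup>2 + (q n)\<^sup>2) / 2)"
      using k am by (intro mult_mono) (auto simp: abs_mult)
    finally have "x * sqrt ((real n + 2) / (real n + 1)) * (q (Suc n) * q n)
        \<le> sqrt (real n + 1) * (((q (Suc n))\<^sup>2 + (q n)\<^sup>2) / 2)" .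
    moreover have "sqrt (real n + 1) * (q (Suc n))\<^sup>2 \<le> sqrt (real n + 2) * (q (Suc n))\<^sup>2"
      by (intro mult_right_mono) auto
    ultimately show ?thesis unfolding W_def by (simp add: field_simps)
  qed
  have W_nonneg: "0 \<le> W n" if "n \<ge> n0" for n
  proof -
    have "0 \<le> sqrt (real n + 1) / 2 * ((q (Suc n))\<^sup>2 + (q n)\<^sup>2)" by simp
    also have "\<dots> \<le> W n" by (rule lower[OF that])
    finally show ?thesis .
  qed
  \<comment> \<open>The product of |x|, the bound 2/(n+1) for \<open>b n\<close>, and the factor
    1/sqrt(n+1) lost when |q_(n+1) q_n| is estimated by W.\<close>
  define e where "e = (\<lambda>n. 2 * \<bar>x\<bar> * real (Suc n) powr (- 3 / 2))"
  have e0: "0 \<le> e n" for n by (simp add: e_def)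
  have "summable (\<lambda>n. real (Suc n) powr (- 3 / 2))"
    by (subst summable_Suc_iff) (simp add: summable_real_powr_iff)
  hence summ: "summable e" unfolding e_def by (rule summable_mult)
  have grow: "W (Suc n) \<le> W n * exp (e n)" if n: "n \<ge> n0" for n
  proof -
    have "\<bar>q (Suc n) * q n\<bar> \<le> ((q (Suc n))\<^sup>2 + (q n)\<^sup>2) / 2"
      using sum_squares_bound[of "\<bar>q (Suc n)\<bar>" "\<bar>q n\<bar>"] by (simp add: abs_mult)
    also have "\<dots> \<le> W n / sqrt (real n + 1)"
      using lower[OF n] by (simp add: field_simps)
    finally have qq: "\<bar>q (Suc n) * q n\<bar> \<le> W n / sqrt (real n + 1)" .
    have "x * b n * (q (Suc n) * q n) \<le> \<bar>x * b n\<bar> * \<bar>q (Suc n) * q n\<bar>"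
      by (metis abs_ge_self abs_mult)
    also have "\<dots> \<le> (\<bar>x\<bar> * (2 / (real n + 1))) * (W n / sqrt (real n + 1))"
    proof (intro mult_mono qq)
      show "\<bar>x * b n\<bar> \<le> \<bar>x\<bar> * (2 / (real n + 1))"
        unfolding abs_mult using b[of n] by (intro mult_left_mono) auto
    qed auto
    also have "\<dots> = W n * e n"
    proof -
      have "real (Suc n) powr (- 3 / 2) = 1 / ((real n + 1) * sqrt (real n + 1))"
        using powr_add[of "real n + 1" 1 "1 / 2"] powr_minus_divide[of "real n + 1" "3 / 2"]
        by (simp add: powr_half_sqrt add.commute)
      thus ?thesis by (simp add: e_def)
    qed
    finally have "W (Suc n) \<le> W n * (1 + e n)" using step[of n] by (simp add: algebra_simps)
    also have "\<dots> \<le> W n * exp (e n)"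
      using W_nonneg[OF n] exp_ge_add_one_self[of "e n"] by (intro mult_left_mono) auto
    finally show ?thesis .
  qed
  \<comment> \<open>A discrete Gronwall argument; summability of e keeps the accumulated factor
    bounded.\<close>
  have bound: "W (n0 + m) \<le> W n0 * exp (\<Sum>k<m. e (n0 + k))" for m
  proof (induction m)
    case (Suc m)
    have "W (n0 + Suc m) \<le> W (n0 + m) * exp (e (n0 + m))" using grow[of "n0 + m"] by simp
    also have "\<dots> \<le> W n0 * exp (\<Sum>k<m. e (n0 + k)) * exp (e (n0 + m))"
      using Suc by (intro mult_right_mono) auto
    finally show ?case by (simp add: exp_add mult_ac)
  qed simp
  define K where "K = W n0 * exp (\<Sum>k. e (n0 + k))"
  have summ': "summable (\<lambda>k. e (n0 + k))"
    using summable_ignore_initial_segment[OF summ, of n0] by (simp only: add.commute)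
  have WK: "W n \<le> K" if "n \<ge> n0" for n
  proof -
    from le_Suc_ex[OF that] obtain m where m: "n = n0 + m" by blast
    have "(\<Sum>k<m. e (n0 + k)) \<le> (\<Sum>k. e (n0 + k))"
      using e0 by (intro sum_le_suminf summ') auto
    hence "W n0 * exp (\<Sum>k<m. e (n0 + k)) \<le> K"
      unfolding K_def using W_nonneg[of n0] by (intro mult_left_mono) auto
    thus ?thesis using bound[of m] m by simp
  qed
  have K0: "K \<ge> 0" using WK[of n0] W_nonneg[of n0] by simp
  show ?thesis
  proof (intro exI[of _ "sqrt (2 * K)"] eventually_mono[OF eventually_ge_at_top[of "Suc n0"]])
    fix m assume "m \<ge> Suc n0"
    then obtain n where n: "m = Suc n" "n \<ge> n0" by (cases m) auto
    \<comment> \<open>With m = n + 1 the root is exactly sqrt(m), so q_m is bounded through W at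
      index m - 1.\<close>
    have "sqrt (real n + 1) / 2 * (q m)\<^sup>2 \<le> sqrt (real n + 1) / 2 * ((q (Suc n))\<^sup>2 + (q n)\<^sup>2)"
      using n by (intro mult_left_mono) auto
    also have "\<dots> \<le> K" using lower[OF n(2)] WK[OF n(2)] by simp
    finally have "(q m)\<^sup>2 \<le> 2 * K / sqrt (real m)" using n by (simp add: field_simps)
    hence "\<bar>q m\<bar> \<le> sqrt (2 * K / sqrt (real m))" by (intro real_le_rsqrt) simp
    also have "\<dots> = sqrt (2 * K) * real m powr (- 1 / 4)"
    proof -
      have "sqrt (sqrt (real m)) = real m powr (1 / 4)"
        by (simp add: powr_half_sqrt[symmetric] powr_powr)
      thus ?thesis by (simp add: real_sqrt_divide powr_minus_divide)
    qed
    finally show "\<bar>q m\<bar> \<le> sqrt (2 * K) * real m powr (- 1 / 4)" .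
  qed
qed

section \<open>Transfer to a general normal weight\<close>

lemma orthonormal_polynomials_normal_standardize:
  assumes Q: "orthonormal_polynomials (normal_density \<mu> \<sigma>) Q" and "\<sigma> \<noteq> 0"
  shows "orthonormal_polynomials std_normal_density (\<lambda>n. pcompose (Q n) [:\<mu>, \<bar>\<sigma>\<bar>:])"
  unfolding orthonormal_polynomials_def
proof (intro conjI allI)
  fix n show "degree (pcompose (Q n) [:\<mu>, \<bar>\<sigma>\<bar>:]) = n"
    using Q \<open>\<sigma> \<noteq> 0\<close> by (simp add: orthonormal_polynomials_def degree_pcompose)
next
  fix i j :: nat
  let ?I = "if i = j then 1 else 0 :: real"
  \<comment> \<open>The substitution y = \<mu> + |\<sigma>| x uses |\<sigma>| because only \<sigma>
    \<noteq> 0 is assumed; the density depends on \<sigma>^2 alone.\<close>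
  have dens: "normal_density \<mu> \<sigma> (\<mu> + \<bar>\<sigma>\<bar> * x) * \<bar>\<sigma>\<bar> = std_normal_density x" for x
    using \<open>\<sigma> \<noteq> 0\<close> by (simp add: normal_density_def real_sqrt_mult power_mult_distrib)
  have "has_bochner_integral lborel (\<lambda>x. poly (Q i) x * poly (Q j) x * normal_density \<mu> \<sigma> x) ?I"
    using Q by (simp add: orthonormal_polynomials_def)
  hence "has_bochner_integral lborel (\<lambda>x. poly (Q i) (\<mu> + \<bar>\<sigma>\<bar> * x) * poly (Q j) (\<mu> + \<bar>\<sigma>\<bar> * x)
      * normal_density \<mu> \<sigma> (\<mu> + \<bar>\<sigma>\<bar> * x)) (?I /\<^sub>R \<bar>\<sigma>\<bar>)"
    using lborel_has_bochner_integral_real_affine_iff[of "\<bar>\<sigma>\<bar>"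
        "\<lambda>x. poly (Q i) x * poly (Q j) x * normal_density \<mu> \<sigma> x" ?I \<mu>] \<open>\<sigma> \<noteq> 0\<close>
    by simp
  from has_bochner_integral_mult_left[OF this, of "\<bar>\<sigma>\<bar>"]
  show "has_bochner_integral lborel (\<lambda>x. poly (pcompose (Q i) [:\<mu>, \<bar>\<sigma>\<bar>:]) x *
      poly (pcompose (Q j) [:\<mu>, \<bar>\<sigma>\<bar>:]) x * std_normal_density x) ?I"
    using \<open>\<sigma> \<noteq> 0\<close> by (cases "i = j") (simp_all add: poly_pcompose dens[symmetric] mult_ac)
qed

lemma orthonormal_polynomials_normal_decay:
  assumes Q: "orthonormal_polynomials (normal_density \<mu> \<sigma>) Q" and "\<sigma> \<noteq> 0"
  shows "\<exists>C. eventually (\<lambda>n. \<bar>poly (Q n) x\<bar> \<le> C * real n powr (- 1 / 4)) sequentially"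
proof -
  define u where "u = (x - \<mu>) / \<bar>\<sigma>\<bar>"
  have x: "x = \<mu> + \<bar>\<sigma>\<bar> * u" using \<open>\<sigma> \<noteq> 0\<close> by (simp add: u_def)
  have "\<bar>poly (Q n) x\<bar> = \<bar>poly (hermite n) u / sqrt (fact n)\<bar>" for n
    using orthonormal_polynomials_std_normal[OF orthonormal_polynomials_normal_standardize[OF assms], of n u]
    by (simp add: poly_pcompose x mult.commute)
  thus ?thesis using three_term_decay[OF normalized_hermite_rec, of u] by simp
qed

section \<open>The spectral expansion\<close>

lemma normal_density_abs: "normal_density \<mu> \<bar>\<sigma>\<bar> = normal_density \<mu> \<sigma>"
  by (simp add: normal_density_def fun_eq_iff)

text \<open>|f Q_n| is split as |f/w| |Q_n| w and estimated by half the sum of the squares. Since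
  Q_n has norm 1, the bound does not depend on n.\<close>

lemma integrable_mult_poly:
  assumes Q: "orthonormal_polynomials w Q" and w: "\<And>x. 0 < w x"
    and f: "f \<in> borel_measurable lborel"
    and f2: "integrable lborel (\<lambda>x. (f x / w x)\<^sup>2 * w x)"
  shows "integrable lborel (\<lambda>x. f x * poly (Q n) x)"
    and "(\<integral>x. \<bar>f x * poly (Q n) x\<bar> \<partial>lborel) \<le> ((\<integral>x. (f x / w x)\<^sup>2 * w x \<partial>lborel) + 1) / 2"
proof -
  have "poly (Q n) \<in> borel_measurable borel"
    by (intro borel_measurable_continuous_onI continuous_intros)
  hence meas: "(\<lambda>x. f x * poly (Q n) x) \<in> borel_measurable lborel"
    using f by measurable
  have QQ: "has_bochner_integral lborel (\<lambda>x. poly (Q n) x * poly (Q n) x * w x) (if n = n then 1 else 0)"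
    using Q unfolding orthonormal_polynomials_def by blast
  define h where "h = (\<lambda>x. ((f x / w x)\<^sup>2 * w x + poly (Q n) x * poly (Q n) x * w x) / 2)"
  have h: "integrable lborel h"
    using f2 QQ by (simp add: h_def has_bochner_integral_iff)
  have le: "\<bar>f x * poly (Q n) x\<bar> \<le> h x" for x
  proof -
    define g where "g = f x / w x"
    have fg: "\<bar>f x\<bar> = \<bar>g\<bar> * w x" using w[of x] by (simp add: g_def)
    have hg: "h x = (g\<^sup>2 + (poly (Q n) x)\<^sup>2) * w x / 2"
      unfolding h_def g_def by (simp only: power2_eq_square distrib_right)
    have "2 * \<bar>g\<bar> * \<bar>poly (Q n) x\<bar> \<le> g\<^sup>2 + (poly (Q n) x)\<^sup>2"
      using sum_squares_bound[of "\<bar>g\<bar>" "\<bar>poly (Q n) x\<bar>"] by (simp only: power2_abs)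
    from mult_right_mono[OF this less_imp_le[OF w[of x]]] show ?thesis
      by (simp add: hg abs_mult fg mult_ac)
  qed
  have h0: "0 \<le> h x" for x using le[of x] by linarith
  show int: "integrable lborel (\<lambda>x. f x * poly (Q n) x)"
    by (rule Bochner_Integration.integrable_bound[OF h meas AE_I2]) (use le h0 in simp)
  have "(\<integral>x. \<bar>f x * poly (Q n) x\<bar> \<partial>lborel) \<le> integral\<^sup>L lborel h"
    by (intro integral_mono integrable_abs int h le)
  also have "\<dots> = ((\<integral>x. (f x / w x)\<^sup>2 * w x \<partial>lborel) + 1) / 2"
    using f2 QQ by (simp add: h_def has_bochner_integral_iff)
  finally show "(\<integral>x. \<bar>f x * poly (Q n) x\<bar> \<partial>lborel) \<le> ((\<integral>x. (f x / w x)\<^sup>2 * w x \<partial>lborel) + 1) / 2" .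
qed

lemma kilbas_saigo_0 [simp]: "kilbas_saigo a m l 0 = 1"
  using powser_sums_zero[of "kilbas_saigo_coeff a m l"]
  by (simp add: kilbas_saigo_def kilbas_saigo_coeff_def sums_iff)

text \<open>The decisive series, with terms O(n^(-5/4)). Its term at n = 0 is 0, since division by 0
  yields 0.\<close>

lemma summable_orthonormal_polynomials_over_n:
  assumes "orthonormal_polynomials (normal_density \<mu> \<sigma>) Q" and "\<sigma> \<noteq> 0"
  shows "summable (\<lambda>n. \<bar>poly (Q n) x\<bar> / real n)"
proof -
  obtain C where C: "eventually (\<lambda>n. \<bar>poly (Q n) x\<bar> \<le> C * real n powr (- 1 / 4)) sequentially"
    using orthonormal_polynomials_normal_decay[OF assms] by blast
  show ?thesis
  proof (rule summable_comparison_test_ev)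
    show "summable (\<lambda>n. C * real n powr (- 5 / 4))"
      by (intro summable_mult) (simp add: summable_real_powr_iff)
    show "eventually (\<lambda>n. norm (\<bar>poly (Q n) x\<bar> / real n) \<le> C * real n powr (- 5 / 4)) sequentially"
      using C eventually_gt_at_top[of 0]
    proof eventually_elim
      case (elim n)
      have "\<bar>poly (Q n) x\<bar> / real n \<le> C * real n powr (- 1 / 4) / real n"
        using elim by (intro divide_right_mono) auto
      also have "\<dots> = C * real n powr (- 5 / 4)"
        using elim powr_diff[of "real n" "- 1 / 4" 1] by simp
      finally show ?case by simp
    qed
  qed
qed

lemma orthonormal_polynomials_normal_bounded:
  assumes "orthonormal_polynomials (normal_density \<mu> \<sigma>) Q" and "\<sigma> \<noteq> 0"
  shows "\<exists>B. \<forall>n. \<bar>poly (Q n) x\<bar> \<le> B"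
proof -
  obtain C where C: "eventually (\<lambda>n. \<bar>poly (Q n) x\<bar> \<le> C * real n powr (- 1 / 4)) sequentially"
    using orthonormal_polynomials_normal_decay[OF assms] by blast
  have lim: "(\<lambda>n. C * real n powr (- 1 / 4)) \<longlonglongrightarrow> 0"
    by real_asymp
  have "(\<lambda>n. poly (Q n) x) \<longlonglongrightarrow> 0"
    by (rule Lim_null_comparison[OF _ lim]) (simp only: real_norm_def C)
  hence "Bseq (\<lambda>n. poly (Q n) x)"
    by (intro convergent_imp_Bseq convergentI)
  thus ?thesis by (auto simp: Bseq_def)
qed

text \<open>Two separate bounds justify termwise integration: pointwise convergence uses a bound on
  Q_n(y) that may depend on y, while the integrals use the L1 bound on f Q_n, uniform in n.\<close>

lemma integral_orthonormal_expansion: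
  fixes c :: "nat \<Rightarrow> real"
  assumes Q: "orthonormal_polynomials (normal_density \<mu> \<sigma>) Q" and \<sigma>: "\<sigma> \<noteq> 0"
    and f: "f \<in> borel_measurable lborel"
    and f2: "integrable lborel (\<lambda>x. (f x / normal_density \<mu> \<sigma> x)\<^sup>2 * normal_density \<mu> \<sigma> x)"
    and c: "summable (\<lambda>n. \<bar>c n\<bar>)"
  shows "(\<lambda>n. c n * (\<integral>y. f y * poly (Q n) y \<partial>lborel)) sums
           (\<integral>y. (\<Sum>n. c n * poly (Q n) y) * f y \<partial>lborel)"
proof -
  have w: "0 < normal_density \<mu> \<sigma> x" for x
    using normal_density_pos[of "\<bar>\<sigma>\<bar>"] \<sigma> by (simp add: normal_density_abs)
  note int = integrable_mult_poly[OF Q w f f2]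
  define u where "u = (\<lambda>n y. c n * (f y * poly (Q n) y))"
  have cQ: "summable (\<lambda>n. \<bar>c n * poly (Q n) y\<bar>)" for y
  proof -
    obtain B where B: "\<And>n. \<bar>poly (Q n) y\<bar> \<le> B"
      using orthonormal_polynomials_normal_bounded[OF Q \<sigma>] by blast
    show ?thesis
    proof (rule summable_comparison_test)
      show "summable (\<lambda>n. \<bar>c n\<bar> * B)" by (rule summable_mult2[OF c])
      show "\<exists>N. \<forall>n\<ge>N. norm \<bar>c n * poly (Q n) y\<bar> \<le> \<bar>c n\<bar> * B"
        using B by (auto simp: abs_mult intro!: mult_left_mono)
    qed
  qed
  have intu: "integrable lborel (u n)" for n
    unfolding u_def by (intro integrable_mult_right int)
  have sumu: "summable (\<lambda>n. norm (u n y))" for y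
    using summable_mult2[OF cQ[of y], of "\<bar>f y\<bar>"] by (simp add: u_def abs_mult mult_ac)
  have sumI: "summable (\<lambda>n. \<integral>y. norm (u n y) \<partial>lborel)"
  proof (rule summable_comparison_test)
    let ?G = "((\<integral>x. (f x / normal_density \<mu> \<sigma> x)\<^sup>2 * normal_density \<mu> \<sigma> x \<partial>lborel) + 1) / 2"
    show "summable (\<lambda>n. \<bar>c n\<bar> * ?G)" by (rule summable_mult2[OF c])
    have "(\<integral>y. norm (u n y) \<partial>lborel) = \<bar>c n\<bar> * (\<integral>y. \<bar>f y * poly (Q n) y\<bar> \<partial>lborel)" for n
      by (simp add: u_def abs_mult)
    thus "\<exists>N. \<forall>n\<ge>N. norm (\<integral>y. norm (u n y) \<partial>lborel) \<le> \<bar>c n\<bar> * ?G"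
      using mult_left_mono[OF int(2) abs_ge_zero] by simp
  qed
  have "(\<Sum>n. u n y) = (\<Sum>n. c n * poly (Q n) y) * f y" for y
    using suminf_mult2[OF summable_rabs_cancel[OF cQ[of y]], of "f y"] by (simp add: u_def mult_ac)
  moreover have "integral\<^sup>L lborel (u n) = c n * (\<integral>y. f y * poly (Q n) y \<partial>lborel)" for n
    by (simp add: u_def)
  ultimately show ?thesis
    using sums_integral[OF intu _ sumI] sumu by simp
qed

theorem theorem6p4:
  fixes \<alpha> \<gamma> \<theta> \<mu> \<sigma> :: real
    and M :: "'a measure"
    and X S :: "real \<Rightarrow> 'a \<Rightarrow> real"
    and Z :: "'a \<Rightarrow> real"
    and Q :: "nat \<Rightarrow> real poly"
    and f :: "real \<Rightarrow> real"
    and a :: "nat \<Rightarrow> real"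
  assumes "0 < \<alpha>" "\<alpha> < 1" "0 \<le> \<gamma>" "0 < \<alpha> + \<gamma>" "\<alpha> + \<gamma> \<le> 1"
    and "0 < \<theta>" "0 < \<sigma>\<^sup>2"
    and "prob_space M"
    and "ou_process M \<theta> \<mu> \<sigma> X"
    and "stable_subordinator M \<alpha> S"
    and "Z = stretch_variable \<gamma> S"
    and "independent_of_process M Z X"
    and "orthonormal_polynomials (normal_density \<mu> \<sigma>) Q"
    and "\<And>x. 0 \<le> f x"
    and "distributed M lborel (stretched_process \<alpha> \<gamma> X Z 0) (\<lambda>x. ennreal (f x))"
    and "integrable lborel (\<lambda>x. (f x / normal_density \<mu> \<sigma> x)\<^sup>2 * normal_density \<mu> \<sigma> x)"
    and "\<And>n. a n = (\<integral>y. f y * poly (Q n) y \<partial>lborel)"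
    and "\<And>c d. uniform_limit {c..d} (\<lambda>N x. \<Sum>n<N. a n * poly (Q n) x)
                 (\<lambda>x. f x / normal_density \<mu> \<sigma> x) sequentially"
  shows "\<forall>x. ((\<lambda>t. stretched_ou_density \<alpha> \<gamma> \<theta> \<mu> \<sigma> Q f t x)
               \<longlongrightarrow> 1 / sqrt (2 * pi * \<sigma>\<^sup>2) * exp (- (x - \<mu>)\<^sup>2 / (2 * \<sigma>\<^sup>2))) at_top"
proof
  fix x :: real
  note Q = assms(13)
  have \<sigma>: "\<sigma> \<noteq> 0" using assms(7) by auto
  have w: "0 < normal_density \<mu> \<sigma> y" for y
    using normal_density_pos[of "\<bar>\<sigma>\<bar>"] \<sigma> by (simp add: normal_density_abs)
  have f_meas: "f \<in> borel_measurable lborel"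
    using distributed_real_measurable[OF _ assms(15)] assms(14) by simp
  \<comment> \<open>The initial density has total mass 1; this fixes the n = 0 term below.\<close>
  have f_int: "(\<integral>y. f y \<partial>lborel) = 1"
  proof -
    interpret prob_space M by (rule assms(8))
    have "emeasure M (stretched_process \<alpha> \<gamma> X Z 0 -` UNIV \<inter> space M) = (\<integral>\<^sup>+y. ennreal (f y) * indicator UNIV y \<partial>lborel)"
      by (rule distributed_emeasure[OF assms(15)]) simp
    hence "(\<integral>\<^sup>+y. ennreal (f y) \<partial>lborel) = 1" by (simp add: emeasure_space_1)
    thus ?thesis using f_meas assms(14) by (simp add: integral_eq_nn_integral)
  qed
  define G where "G = ((\<integral>x. (f x / normal_density \<mu> \<sigma> x)\<^sup>2 * normal_density \<mu> \<sigma> x \<partial>lborel) + 1) / 2"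
  have aG: "\<bar>a n\<bar> \<le> G" for n
  proof -
    have "\<bar>a n\<bar> \<le> (\<integral>y. \<bar>f y * poly (Q n) y\<bar> \<partial>lborel)"
      unfolding assms(17) by (rule integral_abs_bound)
    also have "\<dots> \<le> G"
      unfolding G_def by (rule integrable_mult_poly(2)[OF Q w f_meas assms(16)])
    finally show ?thesis .
  qed
  define E where "E = (\<lambda>t n. kilbas_saigo \<alpha> (1 + \<gamma> / \<alpha>) (\<gamma> / \<alpha>) (- (\<theta> * real n) * t powr (\<alpha> + \<gamma>)))"
  \<comment> \<open>The Kilbas-Saigo constant, divided by the \<theta> of \<lambda>_n = \<theta>
    n.\<close>
  define K where "K = Gamma (1 + \<gamma> + \<alpha>) / Gamma (1 + \<gamma>) / \<theta>"
  have K: "K > 0" using assms by (simp add: K_def Gamma_real_pos)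
  have E0: "E t 0 = 1" for t by (simp add: E_def)
  have E_le: "\<bar>E t n\<bar> \<le> K / t powr (\<alpha> + \<gamma>) / real n" if "t > 0" "n > 0" for t n
  proof -
    have z: "0 < \<theta> * real n * t powr (\<alpha> + \<gamma>)" using that assms by simp
    show ?thesis
      using kilbas_saigo_bounds[OF assms(1-3,5) z]
      by (simp add: E_def K_def field_simps)
  qed
  define D where "D = (\<Sum>n. \<bar>poly (Q n) x\<bar> / real n)"
  note Qn = summable_orthonormal_polynomials_over_n[OF Q \<sigma>, of x]
  \<comment> \<open>Q_0 is a constant k with k^2 = 1; its unknown sign cancels because k occurs both
    in Q_0(x) and in a_0.\<close>
  have a0: "poly (Q 0) x * a 0 = 1"
  proof -
    have "degree (Q 0) = 0" using Q by (simp add: orthonormal_polynomials_def)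
    then obtain k where k: "Q 0 = [:k:]" using degree_eq_zeroE by metis
    have "has_bochner_integral lborel (\<lambda>x. poly (Q 0) x * poly (Q 0) x * normal_density \<mu> \<sigma> x) (if 0 = (0::nat) then 1 else 0)"
      using Q unfolding orthonormal_polynomials_def by blast
    hence "(\<integral>x. k * k * normal_density \<mu> \<sigma> x \<partial>lborel) = 1"
      by (simp add: has_bochner_integral_iff k)
    hence "k * k = 1"
      using integral_normal_density[of "\<bar>\<sigma>\<bar>" \<mu>] \<sigma> by (simp add: normal_density_abs)
    thus ?thesis using f_int by (simp add: assms(17) k)
  qed
  have key: "\<bar>stretched_ou_density \<alpha> \<gamma> \<theta> \<mu> \<sigma> Q f t x - normal_density \<mu> \<sigma> x\<bar>
      \<le> normal_density \<mu> \<sigma> x * (K * G * D) / t powr (\<alpha> + \<gamma>)" if t: "t > 0" for t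
  proof -
    define T where "T = t powr (\<alpha> + \<gamma>)"
    have T: "T > 0" using t by (simp add: T_def)
    define c where "c = (\<lambda>n. E t n * poly (Q n) x)"
    have c_le: "\<bar>c n\<bar> \<le> K / T * (\<bar>poly (Q n) x\<bar> / real n)" if "n > 0" for n
      using mult_right_mono[OF E_le[OF t that], of "\<bar>poly (Q n) x\<bar>"]
      by (simp add: c_def T_def abs_mult mult_ac)
    have c: "summable (\<lambda>n. \<bar>c n\<bar>)"
    proof (rule summable_comparison_test)
      show "summable (\<lambda>n. K / T * (\<bar>poly (Q n) x\<bar> / real n))" by (rule summable_mult[OF Qn])
      \<comment> \<open>The comparison must start at n = 1: at n = 0 the right side is 0, whereas
        \<open>c 0\<close> is Q_0(x).\<close>
      show "\<exists>N. \<forall>n\<ge>N. norm \<bar>c n\<bar> \<le> K / T * (\<bar>poly (Q n) x\<bar> / real n)"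
        using c_le by (intro exI[of _ 1]) auto
    qed
    have "stretched_ou_density \<alpha> \<gamma> \<theta> \<mu> \<sigma> Q f t x =
        normal_density \<mu> \<sigma> x * (\<integral>y. (\<Sum>n. c n * poly (Q n) y) * f y \<partial>lborel)"
      unfolding stretched_ou_density_def stretched_ou_transition_density_def c_def E_def
      by (simp only: mult.assoc integral_mult_right_zero)
    note dens0 = this
    have ca: "(\<lambda>n. c n * a n) sums (\<integral>y. (\<Sum>n. c n * poly (Q n) y) * f y \<partial>lborel)"
      using integral_orthonormal_expansion[OF Q \<sigma> f_meas assms(16) c] unfolding assms(17) .
    have "c 0 * a 0 = 1" using a0 by (simp add: c_def E0)
    hence "(\<integral>y. (\<Sum>n. c n * poly (Q n) y) * f y \<partial>lborel) = 1 + (\<Sum>n. c (Suc n) * a (Suc n))"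
      using suminf_split_head[OF sums_summable[OF ca]] sums_unique[OF ca] by simp
    hence dens: "stretched_ou_density \<alpha> \<gamma> \<theta> \<mu> \<sigma> Q f t x - normal_density \<mu> \<sigma> x =
        normal_density \<mu> \<sigma> x * (\<Sum>n. c (Suc n) * a (Suc n))"
      unfolding dens0 by (simp only: distrib_left)
    have ca_le: "\<bar>c (Suc n) * a (Suc n)\<bar> \<le> K * G / T * (\<bar>poly (Q (Suc n)) x\<bar> / real (Suc n))" for n
      using mult_mono[OF c_le[of "Suc n"] aG[of "Suc n"]] K T
      by (simp add: abs_mult mult_ac)
    have Qs: "summable (\<lambda>n. K * G / T * (\<bar>poly (Q (Suc n)) x\<bar> / real (Suc n)))"
      by (intro summable_mult) (use Qn in \<open>subst summable_Suc_iff\<close>)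
    have "\<bar>\<Sum>n. c (Suc n) * a (Suc n)\<bar> \<le> (\<Sum>n. K * G / T * (\<bar>poly (Q (Suc n)) x\<bar> / real (Suc n)))"
      by (rule norm_suminf_le[of "\<lambda>n. c (Suc n) * a (Suc n)", OF _ Qs, unfolded real_norm_def, OF ca_le])
    also have "\<dots> = K * G / T * (\<Sum>n. \<bar>poly (Q (Suc n)) x\<bar> / real (Suc n))"
      by (rule suminf_mult) (use Qn in \<open>subst summable_Suc_iff\<close>)
    \<comment> \<open>The shift of index loses nothing, because the n = 0 term of D is 0.\<close>
    also have "(\<Sum>n. \<bar>poly (Q (Suc n)) x\<bar> / real (Suc n)) = D"
      unfolding D_def using suminf_split_head[OF Qn] by simp
    finally have "\<bar>\<Sum>n. c (Suc n) * a (Suc n)\<bar> \<le> K * G / T * D" .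
    from mult_left_mono[OF this less_imp_le[OF w[of x]]] show ?thesis
      unfolding dens abs_mult by (simp add: T_def)
  qed
  have "((\<lambda>t. stretched_ou_density \<alpha> \<gamma> \<theta> \<mu> \<sigma> Q f t x - normal_density \<mu> \<sigma> x) \<longlongrightarrow> 0) at_top"
  proof (rule Lim_null_comparison)
    show "eventually (\<lambda>t. norm (stretched_ou_density \<alpha> \<gamma> \<theta> \<mu> \<sigma> Q f t x - normal_density \<mu> \<sigma> x)
        \<le> normal_density \<mu> \<sigma> x * (K * G * D) / t powr (\<alpha> + \<gamma>)) at_top"
      using eventually_gt_at_top[of 0] by eventually_elim (use key in simp)
    show "((\<lambda>t. normal_density \<mu> \<sigma> x * (K * G * D) / t powr (\<alpha> + \<gamma>)) \<longlongrightarrow> 0) at_top"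
      using assms(4) by real_asymp
  qed
  thus "((\<lambda>t. stretched_ou_density \<alpha> \<gamma> \<theta> \<mu> \<sigma> Q f t x)
      \<longlongrightarrow> 1 / sqrt (2 * pi * \<sigma>\<^sup>2) * exp (- (x - \<mu>)\<^sup>2 / (2 * \<sigma>\<^sup>2))) at_top"
    unfolding normal_density_def[symmetric] by (simp add: LIM_zero_iff)
qed

end
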